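(* Let $m$ be a positive integer with $m\equiv 2 \pmod 4$, and let $b_m$ be the coefficient of $z^{-m}$ in the Laurent expansion at infinity $\psi(z)=z+\sum_{m\ge 0} b_m z^{-m}$ of the normalized conformal map $\psi$ from the exterior of the closed unit disk onto the complement of the Mandelbrot set. Then $$-\nu(b_m)=\Bigl\lfloor \tfrac{2}{3}(m+1)\Bigr\rfloor - s\Bigl(\Bigl\lfloor \tfrac{2}{3}(m+1)\Bigr\rfloor\Bigr)+\epsilon(m),$$ where $$\epsilon(m)=\begin{cases}0, & \text{if } m\equiv 22 \pmod{24},\\ 1, & \text{otherwise.}\end{cases}$$
   Context: The Mandelbrot set $M$ is the set of $c\in\mathbb{C}$ for which the sequence defined by $z_0=0$, $z_n=z_{n-1}^2+c$ is bounded. Let $\overline{\mathbb{C}}=\mathbb{C}\cup\{\infty\}$, $\tilde M=\overline{\mathbb{C}}\setminus M$ and $\Delta=\{z\in\overline{\mathbb{C}}: 1<|z|\le\infty\}$. It is known that $\tilde M$ is simply connected with mapping radius $1$, so there is an analytic homeomorphism (conformal bijection) $\psi:\Delta\to\tilde M$ of the form $\psi(z)=z+\sum_{m=0}^\infty b_m z^{-m}$; this defines the coefficients $b_m$. It is known that each $b_m$ is a rational number whose denominator is a power of $2$. $\nu$ denotes the 2-adic valuation (on rational numbers, with $\nu(0)=\infty$). For a non-negative integer $n$, $s(n)$ is the sum of the binary digits of $n$. *)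

theory Defs
  imports
    "HOL-Complex_Analysis.Complex_Analysis"
    "HOL-Computational_Algebra.Computational_Algebra"
    "HOL-Number_Theory.Cong"
begin

primrec mandelbrot_orbit :: "complex \<Rightarrow> nat \<Rightarrow> complex" where
  "mandelbrot_orbit c 0 = 0"
| "mandelbrot_orbit c (Suc n) = (mandelbrot_orbit c n)\<^sup>2 + c"

definition mandelbrot_set :: "complex set" where
  "mandelbrot_set = {c. bounded (range (mandelbrot_orbit c))}"

(* The normalised conformal map of the exterior of the closed unit disc onto the
   complement of the Mandelbrot set, together with its Laurent coefficients.
   Both domains are given by their finite parts: the Laurent expansion
   psi z = z + b 0 + b 1 / z + ... says that psi extends to infinity by
   psi infinity = infinity, so psi is an analytic homeomorphism between the two
   domains on the sphere iff it is one between the finite parts. *)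
definition mandelbrot_exterior_map :: "(complex \<Rightarrow> complex) \<Rightarrow> (nat \<Rightarrow> complex) \<Rightarrow> bool" where
  "mandelbrot_exterior_map \<psi> b \<longleftrightarrow>
     \<psi> holomorphic_on {z. 1 < norm z} \<and>
     (\<exists>\<phi>. homeomorphism {z. 1 < norm z} (- mandelbrot_set) \<psi> \<phi>) \<and>
     (\<forall>z. 1 < norm z \<longrightarrow> (\<lambda>m. b m / z ^ m) sums (\<psi> z - z))"

definition nu2 :: "rat \<Rightarrow> ereal" where
  "nu2 q = (if q = 0 then \<infinity> else
     (case quotient_of q of (n, d) \<Rightarrow>
        ereal (real (multiplicity (2::int) n) - real (multiplicity (2::int) d))))"

fun binary_digit_sum :: "nat \<Rightarrow> nat" where
  "binary_digit_sum n = (if n = 0 then 0 else n mod 2 + binary_digit_sum (n div 2))"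

declare binary_digit_sum.simps [simp del]

definition eps :: "nat \<Rightarrow> nat" where
  "eps m = (if [m = 22] (mod 24) then 0 else 1)"

end

theory Submission
  imports Defs
begin

text \<open>
  The proof has an analytic, an algebraic and an arithmetic part.

  Write \<open>p n\<close> for the polynomial \<open>c \<mapsto> mandelbrot_orbit c (n + 1)\<close>, which is monic of degree
  \<open>2 ^ n\<close>, put \<open>x = 1 / z\<close> and let \<open>A = x \<psi>(1/x) = 1 + b 0 x + b 1 x^2 + \<dots>\<close>. The normalised orbits
  \<open>G n = x ^ (2 ^ n) * p n (\<psi> z)\<close> satisfy \<open>G 0 = A\<close> and \<open>G (n + 1) = G n ^ 2 + x ^ (2 ^ (n + 1) - 1) * A\<close>.

  Analysis: on the Mandelbrot set every \<open>p n\<close> is bounded by 2, and \<open>\<psi> z\<close> tends to that set as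
  \<open>norm z\<close> tends to 1. Hence \<open>norm (p n (\<psi> z)) \<le> 3\<close> on some circle close to the unit circle, and
  Cauchy's inequality bounds each Taylor coefficient of \<open>G n\<close> independently of \<open>n\<close>
  (\<open>scaled_orbit_nth_bound\<close>). But a first nonzero coefficient of \<open>G n\<close> of positive index
  below \<open>2 ^ (n + 1) - 1\<close> would be doubled by every step of the recursion. So there is none
  (\<open>scaled_orbit_gap\<close>), that is, \<open>p n (\<psi> z) = z ^ (2 ^ n) + O(z ^ (1 - 2 ^ n))\<close>.

  Algebra: taking the power \<open>m / 2 ^ n\<close> of this relation gives \<open>z ^ m\<close> as a Laurent series in
  \<open>w = \<psi> z\<close>, up to a small error, and Lagrange inversion reads off
  \<open>- m * b m\<close> as the coefficient of \<open>1 / w\<close> in \<open>p n (w) ^ (m / 2 ^ n)\<close> (\<open>coefficient_formula\<close>).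
  Expanding \<open>p n = p (n - 1) ^ 2 + w\<close> by the binomial series at each level makes this coefficient a
  recursively defined rational number (\<open>orbit_power_Suc_nth\<close>).

  Arithmetic: for \<open>m = 2 * a\<close> with \<open>a\<close> odd, a binomial coefficient at level \<open>r + 2\<close> of the recursion
  has as upper entry an odd integer over \<open>2 ^ (r + 1)\<close>, so its 2-adic valuation is known exactly. Comparing
  valuations with the weight \<open>2 ^ n - 1\<close> that level \<open>n\<close> consumes, level 2 (weight 3) is the
  cheapest: the dominating term uses it \<open>j = (m + 1) div 3\<close> times and has valuation \<open>- v ((2 * j)!)\<close>,
  while a level from 4 on costs at least two powers of 2 (\<open>weight_loss\<close>). The dominating
  term carries an integer binomial coefficient that is odd unless \<open>m \<equiv> 22 (mod 24)\<close>. In the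
  exceptional case three terms compete one power of 2 further down: two of them cancel modulo 2, and the
  third, which uses level 3 once, survives (\<open>orbit_power_valuation_exceptional\<close>). Dividing by \<open>m\<close>,
  of valuation 1, and Legendre's formula for the valuation of a factorial give the result.
\<close>

text \<open>Both power series and vectors use the infix \<open>$\<close>; only the former occur below.\<close>

unbundle no vec_syntax

section \<open>Fractional powers of the orbit polynomials\<close>

lemma fps_mult_compose_nth:
  fixes B R T :: "'a::comm_ring_1 fps"
  assumes "T $ 0 = 0"
  shows "(B * (R oo T)) $ n = (\<Sum>k\<le>n. R $ k * (B * T ^ k) $ n)"
proof -
  have "(B * (R oo T)) $ n = (\<Sum>i\<le>n. \<Sum>k\<le>n. B $ i * (R $ k * T ^ k $ (n - i)))"
  proof (unfold fps_mult_nth atLeast0AtMost, intro sum.cong refl)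
    fix i assume "i \<in> {..n}"
    have "(R oo T) $ (n - i) = (\<Sum>k\<in>{..n - i}. R $ k * T ^ k $ (n - i))"
      by (simp add: fps_compose_nth atLeast0AtMost)
    also have "\<dots> = (\<Sum>k\<le>n. R $ k * T ^ k $ (n - i))"
      using startsby_zero_power_prefix[OF assms] by (intro sum.mono_neutral_left) auto
    finally show "B $ i * (R oo T) $ (n - i) = (\<Sum>k\<le>n. B $ i * (R $ k * T ^ k $ (n - i)))"
      by (simp add: sum_distrib_left)
  qed
  also have "\<dots> = (\<Sum>k\<le>n. R $ k * (B * T ^ k) $ n)"
    by (subst sum.swap) (simp add: fps_mult_nth atLeast0AtMost sum_distrib_left algebra_simps)
  finally show ?thesis .
qed

text \<open>
  In the variable \<open>X = 1 / w\<close>, the polynomial \<open>p n\<close> becomes \<open>w ^ (2 ^ n) * Q n\<close> with \<open>Q 0 = 1\<close> and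
  \<open>Q (n + 1) = Q n ^ 2 + X ^ (2 ^ (n + 1) - 1)\<close>. The series \<open>orbit_power n a\<close> is \<open>Q n ^ a\<close> for an arbitrary
  exponent \<open>a\<close>. The recursion is the binomial series for the last factor of
  \<open>Q (n + 1) ^ a = Q n ^ (2 * a) * (1 + X ^ (2 ^ (n + 1) - 1) * Q n ^ (- 2)) ^ a\<close>.
  Defining all powers at once, instead of \<open>Q n\<close> first and its powers afterwards, avoids having to prove
  that a formal power of a product is the product of the powers: additivity in the exponent,
  together with the recursion for exponent 1, is enough.
\<close>

primrec orbit_power :: "nat \<Rightarrow> 'a::field_char_0 \<Rightarrow> 'a fps" where
  "orbit_power 0 a = 1"
| "orbit_power (Suc n) a =
     orbit_power n (2 * a) * (fps_binomial a oo (fps_X ^ (2 ^ Suc n - 1) * orbit_power n (- 2)))"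

lemma gap_pos: "0 < (2::nat) ^ Suc n - 1"
  using one_less_power[of "2::nat" "Suc n"] by simp

lemma startsby_zero_gap [simp]: "(fps_X ^ (2 ^ Suc n - 1) * F :: 'a::comm_ring_1 fps) $ 0 = 0"
  using gap_pos[of n] by (simp add: fps_X_power_mult_nth)

lemma orbit_power_nth_0 [simp]: "orbit_power n a $ 0 = 1"
  by (induction n arbitrary: a) auto

lemma orbit_power_add: "orbit_power n (a + b) = orbit_power n a * orbit_power n b"
proof (induction n arbitrary: a b)
  case (Suc n)
  have "orbit_power n (2 * (a + b)) = orbit_power n (2 * a) * orbit_power n (2 * b)"
    by (metis Suc distrib_left)
  then show ?case
    unfolding orbit_power.simps fps_binomial_add_mult
      fps_compose_mult_distrib[OF startsby_zero_gap]
    by (simp only: mult_ac)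
qed simp

lemma orbit_power_zero [simp]: "orbit_power n 0 = 1"
  by (induction n) auto

lemma orbit_power_of_nat_mult: "orbit_power n (of_nat k * a) = orbit_power n a ^ k"
  by (induction k) (simp_all add: orbit_power_add algebra_simps)

text \<open>
  This identifies \<open>orbit_power n 1\<close> with the reversed orbit polynomial \<open>Q n\<close>.
\<close>

lemma orbit_power_Suc_one:
  "orbit_power (Suc n) (1::'a::field_char_0) = orbit_power n 1 ^ 2 + fps_X ^ (2 ^ Suc n - 1)"
proof -
  have two: "orbit_power n (2::'a) = orbit_power n 1 ^ 2"
    using orbit_power_of_nat_mult[of n 2 "1::'a"] by simp
  have inv: "orbit_power n (2::'a) * orbit_power n (- 2) = 1"
    using orbit_power_add[of n "2::'a" "-2"] by simp
  have "orbit_power (Suc n) (1::'a)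
      = orbit_power n 2 * (1 + fps_X ^ (2 ^ Suc n - 1) * orbit_power n (- 2))"
    by (simp only: orbit_power.simps fps_binomial_1 fps_compose_add_distrib fps_compose_1
        fps_X_fps_compose_startby0[OF startsby_zero_gap] mult_1_right)
  also have "\<dots> = orbit_power n 1 ^ 2 + fps_X ^ (2 ^ Suc n - 1) * (orbit_power n 2 * orbit_power n (- 2))"
    using two by (simp add: algebra_simps)
  finally show ?thesis using inv by simp
qed

text \<open>
  The binomial expansion, level by level. It turns the coefficients into finite sums of products of
  generalised binomial coefficients, on which all of the arithmetic below is done.
\<close>

lemma orbit_power_Suc_nth:
  "orbit_power (Suc n) a $ w =
     (\<Sum>j\<le>w. if (2 ^ Suc n - 1) * j \<le> w
             then (a gchoose j) * orbit_power n (2 * a - 2 * of_nat j) $ (w - (2 ^ Suc n - 1) * j) else 0)"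
proof -
  define g :: nat where "g = 2 ^ Suc n - 1"
  have pw: "orbit_power n (2 * a) * (fps_X ^ g * orbit_power n (- 2)) ^ j
       = fps_X ^ (g * j) * orbit_power n (2 * a - 2 * of_nat j)" for j
  proof -
    have "orbit_power n (2 * a - 2 * of_nat j) = orbit_power n (2 * a) * orbit_power n (of_nat j * (- 2))"
      using orbit_power_add[of n "2 * a" "of_nat j * (- 2)"] by (simp add: mult.commute)
    then show ?thesis
      unfolding orbit_power_of_nat_mult by (simp add: power_mult_distrib power_mult mult_ac)
  qed
  show ?thesis
    unfolding orbit_power.simps
    by (subst fps_mult_compose_nth[OF startsby_zero_gap], fold g_def)
       (auto simp: pw fps_X_power_mult_nth intro!: sum.cong)
qed

declare orbit_power.simps(2) [simp del]

lemma of_rat_prod: "of_rat (prod f A) = (\<Prod>x\<in>A. of_rat (f x) :: 'a::field_char_0)"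
  by (induction A rule: infinite_finite_induct) (auto simp: of_rat_mult)

lemma of_rat_fact: "of_rat (fact n) = (fact n :: 'a::field_char_0)"
  using of_rat_of_nat_eq[of "fact n", where ?'a = 'a] by simp

lemma of_rat_gbinomial: "of_rat (a gchoose k) = (of_rat a gchoose k :: 'a::field_char_0)"
  by (simp add: gbinomial_prod_rev of_rat_prod of_rat_fact of_rat_divide of_rat_diff)

text \<open>
  The series that arises from the exterior map has complex coefficients; since its exponent is rational,
  they are the images of the coefficients of the same series over the rationals.
\<close>

lemma of_rat_orbit_power_nth:
  "of_rat (orbit_power n a $ w) = (orbit_power n (of_rat a) $ w :: 'a::field_char_0)"
proof (induction n arbitrary: a w)
  case (Suc n)
  show ?case unfolding orbit_power_Suc_nth of_rat_sum
    by (intro sum.cong refl)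
       (simp add: Suc of_rat_mult of_rat_gbinomial of_rat_diff)
qed (simp add: fps_one_nth)

section \<open>Lagrange inversion\<close>

text \<open>
  With \<open>w = A / x\<close>, the series \<open>A - x A'\<close> is \<open>- x^2 dw/dx\<close>. So this is, up to sign, the residue of \<open>w ^ (m - k) dw\<close>,
  which vanishes because the form is exact, unless \<open>k = m + 1\<close>. For \<open>k \<le> m\<close> exactness reads
  \<open>(p + 1) * (A - x A') * A ^ p = (p + 1) * A ^ (p + 1) - x (A ^ (p + 1))'\<close>, whose coefficient of index \<open>p + 1\<close> is 0.
  Working with \<open>A\<close> instead of \<open>w\<close> keeps everything inside power series.
\<close>

lemma residue_power_deriv:
  fixes A :: "'a::field_char_0 fps"
  assumes "A $ 0 = 1" "w \<le> Suc m"
  shows "((A - fps_X * fps_deriv A) * (A ^ m * (fps_X * inverse A) ^ w)) $ Suc m = (if w = Suc m then 1 else 0)"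
proof -
  have inv: "A * inverse A = 1" using assms by (simp add: inverse_mult_eq_1')
  show ?thesis
  proof (cases "w = Suc m")
    case True
    have "A ^ m * (fps_X * inverse A) ^ w = fps_X ^ Suc m * ((A * inverse A) ^ m * inverse A)"
      by (simp add: True power_mult_distrib mult_ac)
    then have "A ^ m * (fps_X * inverse A) ^ w = fps_X ^ Suc m * inverse A"
      by (simp add: inv)
    then have "((A - fps_X * fps_deriv A) * (A ^ m * (fps_X * inverse A) ^ w))
        = fps_X ^ Suc m * (inverse A * (A - fps_X * fps_deriv A))"
      by (simp only: mult_ac)
    then show ?thesis using True assms(1) by (simp only: fps_X_power_mult_nth) simp
  next
    case False
    then obtain p where p: "m = w + p" using assms(2) by (metis le_Suc_eq le_iff_add)
    have "A ^ m * (fps_X * inverse A) ^ w = fps_X ^ w * ((A * inverse A) ^ w * A ^ p)"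
      by (simp add: p power_add power_mult_distrib mult_ac)
    then have *: "A ^ m * (fps_X * inverse A) ^ w = fps_X ^ w * A ^ p"
      by (simp add: inv)
    have "of_nat (Suc p) * ((A - fps_X * fps_deriv A) * A ^ p)
        = of_nat (Suc p) * A ^ Suc p - fps_X * fps_deriv (A ^ Suc p)"
      unfolding fps_deriv_power by (simp add: algebra_simps fps_of_nat[symmetric] del: of_nat_Suc)
    then have "(of_nat (Suc p) * ((A - fps_X * fps_deriv A) * A ^ p)) $ Suc p = 0"
      by (simp add: fps_mult_of_nat_nth del: of_nat_Suc power_Suc)
    then have "((A - fps_X * fps_deriv A) * A ^ p) $ Suc p = 0"
      by (simp add: fps_mult_of_nat_nth del: of_nat_Suc)
    then have "(fps_X ^ w * ((A - fps_X * fps_deriv A) * A ^ p)) $ Suc m = 0"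
      by (simp only: fps_X_power_mult_nth p) simp
    then show ?thesis using False by (simp only: * mult_ac if_False)
  qed
qed

text \<open>
  If \<open>x ^ (- m) = \<Sum>k. R k * w ^ (m - k)\<close> up to terms that are too small to matter, then
  multiplying by \<open>dw\<close> and taking residues leaves only \<open>R (m + 1)\<close> on the right,
  and \<open>- m\<close> times a coefficient of \<open>A\<close> on the left.
\<close>

lemma lagrange_coefficient:
  fixes A H R :: "'a::field_char_0 fps"
  assumes A0: "A $ 0 = 1"
    and H: "H = A ^ m * (R oo (fps_X * inverse A))" "H $ 0 = 1"
       "\<And>k. 0 < k \<Longrightarrow> k \<le> Suc m \<Longrightarrow> H $ k = 0"
  shows "R $ Suc m = - of_nat m * A $ Suc m"
proof -
  define D where "D = A - fps_X * fps_deriv A"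
  have "(D * H) $ Suc m = (\<Sum>i\<le>Suc m. D $ (Suc m - i) * H $ i)"
    unfolding mult.commute[of D H] fps_mult_nth atLeast0AtMost by (simp only: mult.commute)
  also have "\<dots> = (\<Sum>i\<in>{0}. D $ (Suc m - i) * H $ i)"
    using H(3) by (intro sum.mono_neutral_right) auto
  also have "\<dots> = - of_nat m * A $ Suc m"
    by (simp add: D_def H(2) algebra_simps)
  finally have L: "(D * H) $ Suc m = - of_nat m * A $ Suc m" .
  have "(D * H) $ Suc m = ((D * A ^ m) * (R oo (fps_X * inverse A))) $ Suc m"
    by (simp add: H(1) mult_ac)
  also have "\<dots> = (\<Sum>k\<le>Suc m. R $ k * (D * A ^ m * (fps_X * inverse A) ^ k) $ Suc m)"
    by (subst fps_mult_compose_nth) auto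
  also have "\<dots> = (\<Sum>k\<le>Suc m. R $ k * (if k = Suc m then 1 else 0))"
    using residue_power_deriv[OF A0] by (intro sum.cong) (auto simp: D_def mult.assoc)
  also have "\<dots> = R $ Suc m" by simp
  finally show ?thesis using L by simp
qed

text \<open>
  For the series \<open>A\<close> of the exterior map this is the expansion of \<open>p n (\<psi> z) / z ^ (2 ^ n)\<close> in \<open>1 / z\<close>.
\<close>

primrec scaled_orbit :: "'a::comm_ring_1 fps \<Rightarrow> nat \<Rightarrow> 'a fps" where
  "scaled_orbit A 0 = A"
| "scaled_orbit A (Suc n) = scaled_orbit A n ^ 2 + fps_X ^ (2 ^ Suc n - 1) * A"

lemma scaled_orbit_eq_compose:
  fixes A :: "'a::field_char_0 fps"
  assumes "A $ 0 = 1"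
  shows "scaled_orbit A n = A ^ (2 ^ n) * (orbit_power n 1 oo (fps_X * inverse A))"
proof (induction n)
  case (Suc n)
  have inv: "A * inverse A = 1" using assms by (simp add: inverse_mult_eq_1')
  define g :: nat where "g = 2 ^ Suc n - 1"
  have g: "2 ^ Suc n = Suc g" using gap_pos[of n] by (simp add: g_def)
  define T where "T = fps_X * inverse A"
  have "A ^ Suc g * T ^ g = fps_X ^ g * ((A * inverse A) ^ g * A)"
    by (simp add: T_def power_mult_distrib mult_ac)
  then have AT: "A ^ Suc g * T ^ g = fps_X ^ g * A" by (simp add: inv)
  have T0: "T $ 0 = 0" by (simp add: T_def)
  have "A ^ (2 ^ Suc n) * (orbit_power (Suc n) 1 oo T)
      = A ^ (2 ^ Suc n) * ((orbit_power n 1 oo T) ^ 2 + T ^ g)"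
    unfolding orbit_power_Suc_one g_def[symmetric] fps_compose_add_distrib
    using T0 by (simp add: fps_compose_power[symmetric])
  also have "\<dots> = (A ^ (2 ^ n) * (orbit_power n 1 oo T)) ^ 2 + A ^ (2 ^ Suc n) * T ^ g"
    by (simp add: power_mult_distrib power_mult distrib_left mult.commute[of 2])
  also have "\<dots> = scaled_orbit A (Suc n)"
    unfolding scaled_orbit.simps g_def[symmetric] using Suc AT by (simp only: T_def[symmetric] g)
  finally show ?case by (simp add: T_def)
qed simp

text \<open>
  In characteristic 0 a series with constant term 1 is determined by any positive power of it, up to every
  given order.
\<close>

lemma fps_power_eq_one_upto:
  fixes H :: "'a::field_char_0 fps"
  assumes "H $ 0 = 1" "N > 0" "\<And>k. 0 < k \<Longrightarrow> k \<le> K \<Longrightarrow> (H ^ N) $ k = 0"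
  shows "0 < k \<Longrightarrow> k \<le> K \<Longrightarrow> H $ k = 0"
proof (induction k rule: less_induct)
  case (less k)
  have "(H ^ j) $ k = of_nat j * H $ k \<and> (\<forall>i. 0 < i \<and> i < k \<longrightarrow> (H ^ j) $ i = 0)" for j
  proof (induction j)
    case (Suc j)
    have z: "(H ^ j) $ 0 = 1" using assms(1) by (simp add: fps_power_zeroth)
    have a: "(H * H ^ j) $ i = H $ i + (H ^ j) $ i" if "0 < i" "i \<le> k" for i
    proof -
      have "(H * H ^ j) $ i = (\<Sum>l\<le>i. H $ l * (H ^ j) $ (i - l))"
        by (simp add: fps_mult_nth atLeast0AtMost)
      also have "\<dots> = (\<Sum>l\<in>{0,i}. H $ l * (H ^ j) $ (i - l))"
        using that less Suc.IH by (intro sum.mono_neutral_right) auto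
      finally show ?thesis using that z assms(1) by simp
    qed
    show ?case using a[of k] a less Suc by (auto simp: algebra_simps)
  qed (use less.prems in auto)
  from this[of N] assms(3)[OF less.prems] assms(2) show ?case by auto
qed

text \<open>
  The series \<open>H = A ^ m * (Q n ^ (m / 2 ^ n) oo x / A)\<close> has \<open>2 ^ n\<close>-th power \<open>scaled_orbit A n ^ m\<close>. So the
  gap in the scaled orbit passes to \<open>H\<close>, and Lagrange inversion applies.
\<close>

theorem coefficient_eq_orbit_power:
  fixes A :: "'a::field_char_0 fps"
  assumes A0: "A $ 0 = 1"
    and gap: "\<And>k. 0 < k \<Longrightarrow> k \<le> Suc m \<Longrightarrow> scaled_orbit A n $ k = 0"
  shows "orbit_power n (of_nat m / 2 ^ n) $ Suc m = - of_nat m * A $ Suc m"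
proof -
  define T where "T = fps_X * inverse A"
  define R where "R = orbit_power n (of_nat m / 2 ^ n :: 'a)"
  define H where "H = A ^ m * (R oo T)"
  have T0: "T $ 0 = 0" by (simp add: T_def)
  have "R ^ (2 ^ n) = orbit_power n (of_nat m * 1)"
    unfolding R_def by (subst orbit_power_of_nat_mult[symmetric]) simp
  then have RN: "R ^ (2 ^ n) = orbit_power n 1 ^ m"
    by (simp only: orbit_power_of_nat_mult)
  have S0: "scaled_orbit A n $ 0 = 1"
    using A0 T0 by (simp add: scaled_orbit_eq_compose fps_power_zeroth)
  have HN: "H ^ (2 ^ n) = scaled_orbit A n ^ m"
    using T0 unfolding H_def scaled_orbit_eq_compose[OF A0] T_def[symmetric]
    by (simp add: power_mult_distrib fps_compose_power RN power_mult[symmetric] mult.commute)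
  have z: "(scaled_orbit A n ^ j) $ k = 0" if "0 < k" "k \<le> Suc m" for j k
    using that
  proof (induction j arbitrary: k)
    case (Suc j)
    have "(scaled_orbit A n * scaled_orbit A n ^ j) $ k
       = (\<Sum>l\<le>k. scaled_orbit A n $ l * (scaled_orbit A n ^ j) $ (k - l))"
      by (simp add: fps_mult_nth atLeast0AtMost)
    also have "\<dots> = 0"
    proof (intro sum.neutral ballI)
      fix l assume "l \<in> {..k}"
      then show "scaled_orbit A n $ l * (scaled_orbit A n ^ j) $ (k - l) = 0"
        using Suc.IH[of "k - l"] gap[of l] Suc.prems by (cases "l = 0") auto
    qed
    finally show ?case by simp
  qed simp
  have H0: "H $ 0 = 1" using A0 by (simp add: H_def R_def fps_power_zeroth)
  show ?thesis
    using lagrange_coefficient[OF A0, of H m R]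
      fps_power_eq_one_upto[OF H0, of "2 ^ n" "Suc m"] HN z H0
    by (simp add: H_def T_def R_def)
qed

section \<open>The orbit along the exterior map\<close>

text \<open>
  From the point \<open>z\<close> given by the hypotheses on, each step multiplies the norm by at least \<open>norm z - 1\<close>, a fixed
  factor greater than 1, because \<open>norm (w\<^sup>2 + c) \<ge> norm w * norm w - norm c\<close>.
\<close>

lemma mandelbrot_orbit_escape:
  assumes "2 < norm (mandelbrot_orbit c n)" "norm c \<le> norm (mandelbrot_orbit c n)"
  shows "c \<notin> mandelbrot_set"
proof
  let ?z = "mandelbrot_orbit c"
  define r where "r = norm (?z n) - 1"
  have r: "r > 1" using assms by (simp add: r_def)
  have step: "r * norm w \<le> norm (w\<^sup>2 + c)" if "norm (?z n) \<le> norm w" for w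
  proof -
    have "norm w * norm w - norm c \<le> norm (w\<^sup>2 + c)"
      using norm_diff_ineq[of "w\<^sup>2" c] by (simp add: norm_mult power2_eq_square)
    moreover have "norm (?z n) * norm w \<le> norm w * norm w"
      using that by (intro mult_right_mono) auto
    ultimately show ?thesis using that assms(2) by (simp add: r_def algebra_simps)
  qed
  have grow: "norm (?z n) * r ^ k \<le> norm (?z (n + k))" for k
  proof (induction k)
    case (Suc k)
    have "1 \<le> r ^ k" using r by (simp add: one_le_power)
    then have "norm (?z n) * 1 \<le> norm (?z n) * r ^ k" by (intro mult_left_mono) auto
    then have "norm (?z n) \<le> norm (?z (n + k))" using Suc by simp
    from step[OF this] have "r * norm (?z (n + k)) \<le> norm (?z (n + Suc k))" by simp
    moreover have "r * (norm (?z n) * r ^ k) \<le> r * norm (?z (n + k))"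
      using Suc r by (intro mult_left_mono) auto
    ultimately show ?case by (simp add: mult_ac)
  qed simp
  assume "c \<in> mandelbrot_set"
  then obtain B where B: "norm (?z k) \<le> B" for k
    by (auto simp: mandelbrot_set_def bounded_iff)
  obtain k where k: "B < r ^ k" using real_arch_pow[OF r] by blast
  have "1 * r ^ k \<le> norm (?z n) * r ^ k" using assms(1) r by (intro mult_right_mono) auto
  then show False using grow[of k] B[of "n + k"] k by simp
qed

lemma mandelbrot_set_norm_le:
  assumes "c \<in> mandelbrot_set" shows "norm c \<le> 2"
  using mandelbrot_orbit_escape[of c 1] assms by force

lemma mandelbrot_set_orbit_norm_le:
  assumes "c \<in> mandelbrot_set" shows "norm (mandelbrot_orbit c n) \<le> 2"
  using mandelbrot_orbit_escape[of c n] mandelbrot_set_norm_le[OF assms] assms by force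

lemma continuous_on_mandelbrot_orbit: "continuous_on S (\<lambda>c. mandelbrot_orbit c n)"
  by (induction n) (auto intro!: continuous_intros)

locale exterior_map =
  fixes \<psi> :: "complex \<Rightarrow> complex" and b :: "nat \<Rightarrow> complex"
  assumes exterior_map: "mandelbrot_exterior_map \<psi> b"
begin

definition series :: "complex fps" where
  "series = Abs_fps (\<lambda>k. if k = 0 then 1 else b (k - 1))"

lemma series_sums:
  assumes "1 < norm z" shows "(\<lambda>k. series $ k * (1 / z) ^ k) sums (\<psi> z / z)"
proof -
  have z: "z \<noteq> 0" using assms by auto
  have "(\<lambda>m. b m / z ^ m) sums (\<psi> z - z)"
    using exterior_map assms by (auto simp: mandelbrot_exterior_map_def)
  then have "(\<lambda>m. b m / z ^ m / z) sums ((\<psi> z - z) / z)" by (rule sums_divide)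
  moreover have "b m / z ^ m / z = series $ Suc m * (1 / z) ^ Suc m" for m
    using z by (simp add: series_def field_simps)
  ultimately have "(\<lambda>m. series $ Suc m * (1 / z) ^ Suc m) sums ((\<psi> z - z) / z)" by simp
  from sums_Suc[OF this] show ?thesis using z by (simp add: series_def diff_divide_distrib)
qed

lemma series_conv_radius: "1 \<le> fps_conv_radius series"
  unfolding fps_conv_radius_def
proof (rule conv_radius_geI_ex)
  fix r :: real assume r: "0 < r" "ereal r < 1"
  show "\<exists>z. norm z = r \<and> summable (\<lambda>n. series $ n * z ^ n)"
    using series_sums[of "1 / of_real r"] r
    by (intro exI[of _ "of_real r"]) (auto simp: sums_iff norm_divide)
qed

lemma eval_series:
  assumes "1 < norm z" shows "eval_fps series (1 / z) = \<psi> z / z"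
  using series_sums[OF assms] by (simp add: eval_fps_def sums_iff)

lemma scaled_orbit_conv_radius: "1 \<le> fps_conv_radius (scaled_orbit series n)"
proof (induction n)
  case (Suc n)
  have "1 \<le> fps_conv_radius (scaled_orbit series n ^ 2)"
    using Suc fps_conv_radius_power order_trans by blast
  moreover have "1 \<le> fps_conv_radius (fps_X ^ (2 ^ Suc n - 1) * series)"
    using fps_conv_radius_mult[of "fps_X ^ (2 ^ Suc n - 1)" series] series_conv_radius
    by (simp add: min_def split: if_splits)
  ultimately show ?case
    unfolding scaled_orbit.simps
    using fps_conv_radius_add[of "scaled_orbit series n ^ 2" "fps_X ^ (2 ^ Suc n - 1) * series"]
    by (auto simp: min_def split: if_splits intro: order_trans)
qed (simp add: series_conv_radius)

lemma eval_scaled_orbit: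
  assumes "1 < norm z"
  shows "eval_fps (scaled_orbit series n) (1 / z) = mandelbrot_orbit (\<psi> z) (Suc n) / z ^ (2 ^ n)"
proof (induction n)
  case 0
  then show ?case using eval_series[OF assms] by simp
next
  case (Suc n)
  have z: "z \<noteq> 0" using assms by auto
  have nz: "ereal (norm (1 / z)) < 1" using assms by (simp add: norm_divide divide_less_eq)
  note conv = less_le_trans[OF nz]
  define g :: nat where "g = 2 ^ Suc n - 1"
  have g: "2 ^ Suc n = Suc g" using gap_pos[of n] by (simp add: g_def)
  have c1: "ereal (norm (1 / z)) < fps_conv_radius (scaled_orbit series n)"
    and c2: "ereal (norm (1 / z)) < fps_conv_radius series"
    by (intro conv scaled_orbit_conv_radius series_conv_radius)+
  have c3: "ereal (norm (1 / z)) < fps_conv_radius (scaled_orbit series n ^ 2)"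
    using c1 fps_conv_radius_power less_le_trans by blast
  have c4: "ereal (norm (1 / z)) < fps_conv_radius (fps_X ^ g * series)"
    using fps_conv_radius_mult[of "fps_X ^ g" series] c2
    by (simp add: min_def split: if_splits)
  have "eval_fps (scaled_orbit series (Suc n)) (1 / z)
      = eval_fps (scaled_orbit series n) (1 / z) ^ 2 + (1 / z) ^ g * (\<psi> z / z)"
    unfolding scaled_orbit.simps g_def[symmetric]
    using c1 c2 c3 c4 eval_series[OF assms]
    by (simp add: eval_fps_add eval_fps_mult eval_fps_power)
  also have "\<dots> = mandelbrot_orbit (\<psi> z) (Suc n) ^ 2 / z ^ (2 ^ Suc n) + \<psi> z / z ^ Suc g"
    using Suc by (simp add: power_divide power_mult[symmetric] mult.commute)
  also have "\<dots> = mandelbrot_orbit (\<psi> z) (Suc (Suc n)) / z ^ (2 ^ Suc n)"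
    unfolding g by (simp add: add_divide_distrib)
  finally show ?case .
qed

lemma inverse_map:
  obtains \<phi> where "continuous_on {z. 1 < norm z} \<psi>" "continuous_on (- mandelbrot_set) \<phi>"
    and "\<And>z. 1 < norm z \<Longrightarrow> \<phi> (\<psi> z) = z"
    and "\<And>w. w \<notin> mandelbrot_set \<Longrightarrow> \<psi> (\<phi> w) = w"
    and "\<And>w. w \<notin> mandelbrot_set \<Longrightarrow> 1 < norm (\<phi> w)"
proof -
  obtain \<phi> where "homeomorphism {z. 1 < norm z} (- mandelbrot_set) \<psi> \<phi>"
    using exterior_map by (auto simp: mandelbrot_exterior_map_def)
  then show ?thesis
    unfolding homeomorphism_def by (intro that[of \<phi>]) blast+
qed

lemma series_near_zero:
  obtains d where "0 < d" "\<And>x. norm x < d \<Longrightarrow> norm (eval_fps series x - 1) < 1/2"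
proof -
  have "ereal (norm (0::complex)) < fps_conv_radius series"
    using less_le_trans[OF _ series_conv_radius, of 0] by (simp add: zero_ereal_def)
  then have "isCont (eval_fps series) 0" by (intro continuous_eval_fps) simp
  then obtain d where "0 < d"
    and d: "\<And>x. dist x 0 < d \<Longrightarrow> dist (eval_fps series x) (eval_fps series 0) < 1/2"
    unfolding continuous_at_eps_delta dist_norm by (metis half_gt_zero zero_less_one)
  moreover have "eval_fps series 0 = 1" by (simp add: eval_fps_at_0 series_def)
  ultimately show ?thesis by (intro that[of d]) (auto simp: dist_norm)
qed

text \<open>
  This excludes that \<open>\<psi>\<close> has large values near the unit circle. The complement \<open>U\<close> of a large disc is connected,
  and its preimage under \<open>\<psi>\<close> misses the circle of radius 2 but contains points outside of it, because \<open>\<psi> z\<close>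
  grows like \<open>z\<close>. So the whole preimage lies outside of that circle.
\<close>

lemma bounded_near_circle:
  obtains S where "\<And>z. 1 < norm z \<Longrightarrow> norm z \<le> 2 \<Longrightarrow> norm (\<psi> z) \<le> S"
proof -
  obtain \<phi> where cont: "continuous_on {z. 1 < norm z} \<psi>" "continuous_on (- mandelbrot_set) \<phi>"
    and \<phi>\<psi>: "\<And>z. 1 < norm z \<Longrightarrow> \<phi> (\<psi> z) = z"
    and \<psi>\<phi>: "\<And>w. w \<notin> mandelbrot_set \<Longrightarrow> \<psi> (\<phi> w) = w"
    using inverse_map by metis
  have "continuous_on (sphere 0 2) \<psi>"
    by (rule continuous_on_subset[OF cont(1)]) auto
  then have "bounded (\<psi> ` sphere 0 2)"
    by (intro compact_imp_bounded compact_continuous_image) auto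
  then obtain S0 where S0: "\<And>z. norm z = 2 \<Longrightarrow> norm (\<psi> z) \<le> S0"
    unfolding bounded_iff by (metis image_eqI mem_sphere_0)
  define S where "S = max S0 2"
  define U where "U = - cball (0::complex) S"
  have UM: "w \<notin> mandelbrot_set" if "w \<in> U" for w
    using that mandelbrot_set_norm_le[of w] by (auto simp: U_def S_def)
  have "connected U"
    unfolding U_def by (rule connected_complement_bounded_convex) auto
  moreover have "continuous_on U (\<lambda>w. norm (\<phi> w))"
    using UM by (intro continuous_on_norm continuous_on_subset[OF cont(2)]) auto
  ultimately have con: "connected ((\<lambda>w. norm (\<phi> w)) ` U)"
    by (intro connected_continuous_image)
  obtain d where d: "d > 0" "\<And>x. norm x < d \<Longrightarrow> norm (eval_fps series x - 1) < 1/2"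
    using series_near_zero by blast
  \<comment> \<open>Chosen so large that \<open>\<psi> t\<close> lies outside of the disc of radius \<open>S\<close>.\<close>
  define t where "t = 1 + max (1 / d) (max 2 (2 * S))"
  have t: "t > 2" "t > 2 * S" "1 / d < t" by (auto simp: t_def)
  then have td: "1 / t < d" using d(1) by (simp add: field_simps)
  have tU: "\<psi> (of_real t) \<in> U"
  proof -
    let ?z = "complex_of_real t"
    have n: "norm ?z = t" using t by simp
    have "norm (1 - eval_fps series (1 / ?z)) < 1/2"
      using td t d(2)[of "1 / ?z"] by (simp add: norm_divide norm_minus_commute)
    then have "1/2 \<le> norm (eval_fps series (1 / ?z))"
      using norm_triangle_ineq2[of 1 "1 - eval_fps series (1 / ?z)"] by simp
    also have "\<dots> = norm (\<psi> ?z) / t"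
      using eval_series[of ?z] t n by (simp add: norm_divide)
    finally have "t \<le> 2 * norm (\<psi> ?z)" using t by (simp add: field_simps)
    then show ?thesis using t by (simp add: U_def)
  qed
  have far: "2 < norm (\<phi> w)" if w: "w \<in> U" for w
  proof (rule ccontr)
    assume neg: "\<not> 2 < norm (\<phi> w)"
    have "norm (\<phi> (\<psi> (of_real t))) = t" using \<phi>\<psi>[of "of_real t"] t by simp
    then have "t \<in> (\<lambda>w. norm (\<phi> w)) ` U" using tU by (metis image_eqI)
    moreover have "norm (\<phi> w) \<in> (\<lambda>w. norm (\<phi> w)) ` U" using w by auto
    ultimately have "{norm (\<phi> w)..t} \<subseteq> (\<lambda>w. norm (\<phi> w)) ` U"
      using connected_contains_Icc[OF con] by blast
    moreover have "2 \<in> {norm (\<phi> w)..t}" using neg t by simp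
    ultimately have "2 \<in> (\<lambda>w. norm (\<phi> w)) ` U" by blast
    then obtain v where v: "v \<in> U" "norm (\<phi> v) = 2" by auto
    with S0[of "\<phi> v"] \<psi>\<phi>[of v] UM[of v] show False by (simp add: U_def S_def)
  qed
  show ?thesis
  proof (rule that[of S])
    fix z :: complex assume z: "1 < norm z" "norm z \<le> 2"
    show "norm (\<psi> z) \<le> S"
    proof (rule ccontr)
      assume "\<not> norm (\<psi> z) \<le> S"
      then have "\<psi> z \<in> U" by (simp add: U_def)
      from far[OF this] show False using z \<phi>\<psi>[of z] by simp
    qed
  qed
qed

text \<open>
  The points where the orbit polynomial is at least 3 stay away from the Mandelbrot set. Those that \<open>\<psi>\<close> can
  reach from \<open>1 < norm z \<le> 2\<close> form a compact set, hence so do their preimages, which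
  therefore keep a positive distance from the unit circle.
\<close>

lemma orbit_small_near_circle:
  obtains \<rho> where "1 < \<rho>" "\<rho> < 2"
    "\<And>z. norm z = \<rho> \<Longrightarrow> norm (mandelbrot_orbit (\<psi> z) n) \<le> 3"
proof -
  obtain \<phi> where cont: "continuous_on (- mandelbrot_set) \<phi>"
    and \<phi>\<psi>: "\<And>z. 1 < norm z \<Longrightarrow> \<phi> (\<psi> z) = z"
    and \<phi>gt: "\<And>w. w \<notin> mandelbrot_set \<Longrightarrow> 1 < norm (\<phi> w)"
    using inverse_map by metis
  obtain S where S: "\<And>z. 1 < norm z \<Longrightarrow> norm z \<le> 2 \<Longrightarrow> norm (\<psi> z) \<le> S"
    using bounded_near_circle by blast
  define K where "K = cball 0 S \<inter> {w. 3 \<le> norm (mandelbrot_orbit w n)}"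
  \<comment> \<open>The extra element 2 keeps the set nonempty and the radius that is chosen below it smaller than 2.\<close>
  define N where "N = insert 2 ((\<lambda>w. norm (\<phi> w)) ` K)"
  have "closed {w. 3 \<le> norm (mandelbrot_orbit w n)}"
    by (intro closed_Collect_le continuous_intros continuous_on_mandelbrot_orbit)
  then have K: "compact K" unfolding K_def by (intro compact_Int_closed) auto
  have KM: "w \<notin> mandelbrot_set" if "w \<in> K" for w
    using that mandelbrot_set_orbit_norm_le[of w n] by (auto simp: K_def)
  have "continuous_on K (\<lambda>w. norm (\<phi> w))"
    using KM by (intro continuous_on_norm continuous_on_subset[OF cont]) auto
  then have "compact N"
    using K unfolding N_def by (intro compact_insert compact_continuous_image)
  then obtain s where s: "s \<in> N" "\<And>x. x \<in> N \<Longrightarrow> s \<le> x"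
    using compact_attains_inf[of N] by (auto simp: N_def)
  have "1 < s" using s(1) KM \<phi>gt by (auto simp: N_def)
  moreover have "s \<le> 2" using s(2) by (simp add: N_def)
  ultimately obtain \<rho> where \<rho>: "1 < \<rho>" "\<rho> < s" "\<rho> < 2"
    using dense[of 1 s] by auto
  show ?thesis
  proof (rule that[of \<rho>])
    fix z :: complex assume z: "norm z = \<rho>"
    show "norm (mandelbrot_orbit (\<psi> z) n) \<le> 3"
    proof (rule ccontr)
      assume "\<not> ?thesis"
      then have "\<psi> z \<in> K" using S[of z] z \<rho> by (simp add: K_def)
      then have "norm (\<phi> (\<psi> z)) \<in> N" unfolding N_def by blast
      then show False using s(2) z \<rho> \<phi>\<psi>[of z] by force
    qed
  qed (use \<rho> in auto)
qed

text \<open>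
  Cauchy's inequality on the circle of radius \<open>1 / \<rho>\<close>. The radius depends on \<open>n\<close>, but \<open>\<rho> < 2\<close> gives a bound that
  is uniform in \<open>n\<close>.
\<close>

lemma scaled_orbit_nth_bound: "norm (scaled_orbit series n $ k) \<le> 3 * 2 ^ k"
proof -
  obtain \<rho> where \<rho>: "1 < \<rho>" "\<rho> < 2"
    and small: "\<And>z. norm z = \<rho> \<Longrightarrow> norm (mandelbrot_orbit (\<psi> z) (Suc n)) \<le> 3"
    using orbit_small_near_circle[of "Suc n"] by blast
  let ?F = "scaled_orbit series n"
  have sub: "cball (0::complex) (1 / \<rho>) \<subseteq> eball 0 (fps_conv_radius ?F)"
  proof (rule subsetI)
    fix x :: complex assume "x \<in> cball 0 (1 / \<rho>)"
    then have "norm x \<le> 1 / \<rho>" by simp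
    also have "1 / \<rho> < 1" using \<rho> by simp
    finally have "ereal (norm x) < 1" by simp
    from less_le_trans[OF this scaled_orbit_conv_radius[of n]]
    show "x \<in> eball 0 (fps_conv_radius ?F)" by simp
  qed
  have "norm ((deriv ^^ k) (eval_fps ?F) 0) \<le> fact k * 3 / (1 / \<rho>) ^ k"
  proof (rule Cauchy_inequality[where f = "eval_fps ?F" and \<xi> = 0 and r = "1 / \<rho>" and B = 3])
    show "eval_fps ?F holomorphic_on ball 0 (1 / \<rho>)"
      by (intro holomorphic_on_eval_fps order_trans[OF ball_subset_cball sub])
    show "continuous_on (cball 0 (1 / \<rho>)) (eval_fps ?F)"
      by (rule continuous_on_subset[OF continuous_on_eval_fps sub])
    fix x :: complex assume x': "norm (0 - x) = 1 / \<rho>"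
    have "norm x = 1 / \<rho>" using x' by simp
    then have x: "norm (1 / x) = \<rho>" using \<rho> by (simp add: norm_divide)
    have "eval_fps ?F x = mandelbrot_orbit (\<psi> (1 / x)) (Suc n) / (1 / x) ^ (2 ^ n)"
      using eval_scaled_orbit[of "1 / x" n] x \<rho> by simp
    then have "norm (eval_fps ?F x) = norm (mandelbrot_orbit (\<psi> (1 / x)) (Suc n)) / \<rho> ^ (2 ^ n)"
      by (simp only: norm_divide[of _ "(1 / x) ^ (2 ^ n)"] norm_power x)
    also have "\<dots> \<le> 3 / 1"
      using small[OF x(1)] \<rho> by (intro frac_le) (auto intro: one_le_power)
    finally show "norm (eval_fps ?F x) \<le> 3" by simp
  qed (use \<rho> in auto)
  moreover have "?F $ k = (deriv ^^ k) (eval_fps ?F) 0 / fact k"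
    using less_le_trans[OF _ scaled_orbit_conv_radius[of n], of 0] by (intro fps_nth_conv_deriv) simp
  ultimately have "norm (?F $ k) \<le> 3 / (1 / \<rho>) ^ k"
    by (simp add: norm_divide pos_divide_le_eq mult.commute)
  also have "\<dots> = 3 * \<rho> ^ k" using \<rho> by (simp add: power_one_over)
  also have "\<dots> \<le> 3 * 2 ^ k" using \<rho> by (intro mult_left_mono power_mono) auto
  finally show ?thesis .
qed

lemma scaled_orbit_nth_0: "scaled_orbit series n $ 0 = 1"
proof (induction n)
  case (Suc n)
  then show ?case
    using startsby_zero_gap[of n series] by (simp add: fps_power_zeroth del: power_Suc)
qed (simp add: series_def)

text \<open>
  Let \<open>k\<close> be the least index that violates the claim for some \<open>n\<close>. The recursion adds \<open>A\<close> only from index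
  \<open>2 ^ (n + 1) - 1\<close> on, and squaring a series \<open>1 + c x ^ k + \<dots>\<close> doubles \<open>c\<close>. So the coefficient of index \<open>k\<close>
  grows like \<open>2 ^ i\<close> along the recursion, against the uniform bound.
\<close>

lemma scaled_orbit_gap: "0 < k \<Longrightarrow> k < 2 ^ Suc n - 1 \<Longrightarrow> scaled_orbit series n $ k = 0"
proof (induction k arbitrary: n rule: less_induct)
  case (less k)
  let ?F = "scaled_orbit series"
  have le: "(2::nat) ^ Suc n \<le> 2 ^ Suc (n + i)" for i by simp
  have double: "?F (Suc (n + i)) $ k = 2 * ?F (n + i) $ k" for i
  proof -
    have "(?F (n + i) ^ 2) $ k = (\<Sum>l\<le>k. ?F (n + i) $ l * ?F (n + i) $ (k - l))"
      by (simp add: power2_eq_square fps_mult_nth atLeast0AtMost)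
    also have "\<dots> = (\<Sum>l\<in>{0, k}. ?F (n + i) $ l * ?F (n + i) $ (k - l))"
    proof (intro sum.mono_neutral_right ballI)
      fix l assume l: "l \<in> {..k} - {0, k}"
      then have "l < 2 ^ Suc (n + i) - 1" using less.prems le[of i] by (simp only: atMost_iff Diff_iff) linarith
      then have "?F (n + i) $ l = 0" using l less.IH[of l "n + i"] by auto
      then show "?F (n + i) $ l * ?F (n + i) $ (k - l) = 0" by simp
    qed auto
    also have "\<dots> = 2 * ?F (n + i) $ k"
      using less.prems by (simp add: scaled_orbit_nth_0)
    moreover have "k < 2 ^ Suc (n + i) - 1" using less.prems le[of i] by linarith
    ultimately show ?thesis
      unfolding scaled_orbit.simps fps_add_nth fps_X_power_mult_nth by (simp only: if_True add_0_right)
  qed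
  have pow: "?F (n + i) $ k = 2 ^ i * ?F n $ k" for i
    using double by (induction i) auto
  show ?case
  proof (rule ccontr)
    assume "?F n $ k \<noteq> 0"
    then obtain i where "3 * 2 ^ k / norm (?F n $ k) < 2 ^ i"
      using real_arch_pow[of 2] by auto
    then have "3 * 2 ^ k < norm (?F (n + i) $ k)"
      using \<open>?F n $ k \<noteq> 0\<close> unfolding pow by (simp add: norm_mult norm_power field_simps)
    then show False using scaled_orbit_nth_bound[of "n + i" k] by simp
  qed
qed

theorem coefficient_formula:
  assumes "Suc m < 2 ^ Suc n - 1"
  shows "orbit_power n (of_nat m / 2 ^ n) $ Suc m = - of_nat m * b m"
  using coefficient_eq_orbit_power[of series m n] scaled_orbit_gap[of _ n] assms
  by (simp add: series_def)

end
section \<open>Two-adic valuations of rational numbers\<close>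

text \<open>
  Explicit fractions make 0 satisfy every lower bound, so that sums and vanishing binomial coefficients
  need no case distinction.
\<close>

definition two_adic_ge :: "rat \<Rightarrow> int \<Rightarrow> bool" where
  "two_adic_ge q e \<longleftrightarrow> (\<exists>a d. odd d \<and> q = of_int a / of_int d * 2 powi e)"

definition two_adic_eq :: "rat \<Rightarrow> int \<Rightarrow> bool" where
  "two_adic_eq q e \<longleftrightarrow> (\<exists>a d. odd a \<and> odd d \<and> q = of_int a / of_int d * 2 powi e)"

lemma odd_imp_of_int_nz: "odd d \<Longrightarrow> (of_int d :: rat) \<noteq> 0"
  by auto

lemma two_adic_eq_imp_ge: "two_adic_eq q e \<Longrightarrow> two_adic_ge q e"
  by (auto simp: two_adic_eq_def two_adic_ge_def)

lemma two_adic_ge_zero [simp]: "two_adic_ge 0 e"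
  unfolding two_adic_ge_def by (intro exI[of _ 0] exI[of _ 1]) auto

lemma two_adic_ge_mono:
  assumes "two_adic_ge q e" "e' \<le> e" shows "two_adic_ge q e'"
proof -
  obtain a d where ad: "odd d" "q = of_int a / of_int d * 2 powi e"
    using assms(1) by (auto simp: two_adic_ge_def)
  have "(2::rat) powi e = 2 ^ nat (e - e') * 2 powi e'"
    using assms(2) by (simp flip: power_int_of_nat power_int_add)
  then have "q = of_int (a * 2 ^ nat (e - e')) / of_int d * 2 powi e'"
    by (simp add: ad(2))
  then show ?thesis using ad(1) unfolding two_adic_ge_def by blast
qed

lemma two_adic_ge_mult:
  assumes "two_adic_ge p e" "two_adic_ge q f" shows "two_adic_ge (p * q) (e + f)"
proof -
  obtain a d where ad: "odd d" "p = of_int a / of_int d * 2 powi e"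
    using assms(1) by (auto simp: two_adic_ge_def)
  obtain b c where bc: "odd c" "q = of_int b / of_int c * 2 powi f"
    using assms(2) by (auto simp: two_adic_ge_def)
  have "p * q = of_int (a * b) / of_int (d * c) * 2 powi (e + f)"
    by (simp add: ad bc power_int_add)
  moreover have "odd (d * c)" using ad(1) bc(1) by simp
  ultimately show ?thesis unfolding two_adic_ge_def by blast
qed

lemma two_adic_eq_mult:
  assumes "two_adic_eq p e" "two_adic_eq q f" shows "two_adic_eq (p * q) (e + f)"
proof -
  obtain a d where ad: "odd a" "odd d" "p = of_int a / of_int d * 2 powi e"
    using assms(1) by (auto simp: two_adic_eq_def)
  obtain b c where bc: "odd b" "odd c" "q = of_int b / of_int c * 2 powi f"
    using assms(2) by (auto simp: two_adic_eq_def)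
  have "p * q = of_int (a * b) / of_int (d * c) * 2 powi (e + f)"
    by (simp add: ad bc power_int_add)
  moreover have "odd (d * c)" "odd (a * b)" using ad bc by simp_all
  ultimately show ?thesis unfolding two_adic_eq_def by blast
qed

lemma two_adic_eq_inverse:
  assumes "two_adic_eq p e" shows "two_adic_eq (inverse p) (- e)"
proof -
  obtain a d where ad: "odd a" "odd d" "p = of_int a / of_int d * 2 powi e"
    using assms(1) by (auto simp: two_adic_eq_def)
  then have "inverse p = of_int d / of_int a * 2 powi (- e)"
    by (simp add: power_int_minus divide_inverse)
  with ad show ?thesis unfolding two_adic_eq_def by blast
qed

lemma two_adic_eq_divide:
  "two_adic_eq p e \<Longrightarrow> two_adic_eq q f \<Longrightarrow> two_adic_eq (p / q) (e - f)"
  using two_adic_eq_mult[OF _ two_adic_eq_inverse] by (fastforce simp: divide_inverse)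

lemma two_adic_ge_add:
  assumes "two_adic_ge p e" "two_adic_ge q e" shows "two_adic_ge (p + q) e"
proof -
  obtain a d where ad: "odd d" "p = of_int a / of_int d * 2 powi e"
    using assms(1) by (auto simp: two_adic_ge_def)
  obtain b c where bc: "odd c" "q = of_int b / of_int c * 2 powi e"
    using assms(2) by (auto simp: two_adic_ge_def)
  have "p + q = of_int (a * c + b * d) / of_int (d * c) * 2 powi e"
    using odd_imp_of_int_nz[OF ad(1)] odd_imp_of_int_nz[OF bc(1)] by (simp add: ad bc field_simps)
  moreover have "odd (d * c)" using ad bc by simp
  ultimately show ?thesis unfolding two_adic_ge_def by blast
qed

lemma two_adic_ge_sum:
  "(\<And>x. x \<in> X \<Longrightarrow> two_adic_ge (h x) e) \<Longrightarrow> two_adic_ge (sum h X) e"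
  by (induction X rule: infinite_finite_induct) (auto intro: two_adic_ge_add)

lemma two_adic_eq_add_ge:
  assumes "two_adic_eq p e" "two_adic_ge q (e + 1)" shows "two_adic_eq (p + q) e"
proof -
  obtain a d where ad: "odd a" "odd d" "p = of_int a / of_int d * 2 powi e"
    using assms(1) by (auto simp: two_adic_eq_def)
  obtain b c where bc: "odd c" "q = of_int b / of_int c * 2 powi (e + 1)"
    using assms(2) by (auto simp: two_adic_ge_def)
  have "p + q = of_int (a * c + 2 * b * d) / of_int (d * c) * 2 powi e"
    using odd_imp_of_int_nz[OF ad(2)] odd_imp_of_int_nz[OF bc(1)]
    by (simp add: ad bc power_int_add field_simps)
  moreover have "odd (d * c)" "odd (a * c + 2 * b * d)" using ad bc by simp_all
  ultimately show ?thesis unfolding two_adic_eq_def by blast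
qed

lemma two_adic_eq_add_eq:
  assumes "two_adic_eq p e" "two_adic_eq q e" shows "two_adic_ge (p + q) (e + 1)"
proof -
  obtain a d where ad: "odd a" "odd d" "p = of_int a / of_int d * 2 powi e"
    using assms(1) by (auto simp: two_adic_eq_def)
  obtain b c where bc: "odd b" "odd c" "q = of_int b / of_int c * 2 powi e"
    using assms(2) by (auto simp: two_adic_eq_def)
  have "even (a * c + b * d)" using ad bc by simp
  then obtain k where k: "a * c + b * d = 2 * k" by (elim evenE)
  have "p + q = of_int (a * c + b * d) / of_int (d * c) * 2 powi e"
    using odd_imp_of_int_nz[OF ad(2)] odd_imp_of_int_nz[OF bc(2)] by (simp add: ad bc field_simps)
  then have "p + q = of_int k / of_int (d * c) * 2 powi (e + 1)"
    unfolding k by (simp add: power_int_add)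
  moreover have "odd (d * c)" using ad bc by simp
  ultimately show ?thesis unfolding two_adic_ge_def by blast
qed

lemma two_adic_ge_of_int: "two_adic_ge (of_int a) 0"
  unfolding two_adic_ge_def by (intro exI[of _ a] exI[of _ 1]) auto

lemma two_adic_eq_of_int: "odd a \<Longrightarrow> two_adic_eq (of_int a) 0"
  unfolding two_adic_eq_def by (intro exI[of _ a] exI[of _ 1]) auto

lemma two_adic_eq_power_int: "two_adic_eq (2 powi e) e"
  unfolding two_adic_eq_def by (intro exI[of _ 1] exI[of _ 1]) auto

lemma two_adic_eq_of_nat:
  assumes "n > 0" shows "two_adic_eq (of_nat n) (int (multiplicity 2 n))"
proof -
  obtain y where y: "n = 2 ^ multiplicity 2 n * y" "\<not> 2 dvd y"
    using multiplicity_decompose'[of n 2] assms by auto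
  have "(of_nat n :: rat) = of_int (int y) / of_int 1 * 2 powi (int (multiplicity 2 n))"
    by (subst y(1)) simp
  moreover have "odd (int y)" using y(2) by simp
  ultimately show ?thesis unfolding two_adic_eq_def by (metis odd_one)
qed

lemma two_adic_eq_prod:
  "finite X \<Longrightarrow> (\<And>x. x \<in> X \<Longrightarrow> two_adic_eq (h x) e) \<Longrightarrow> two_adic_eq (prod h X) (int (card X) * e)"
proof (induction X rule: finite_induct)
  case empty
  show ?case using two_adic_eq_of_int[of 1] by simp
next
  case (insert x X)
  then have "two_adic_eq (h x * prod h X) (e + int (card X) * e)"
    by (intro two_adic_eq_mult) auto
  then show ?case using insert by (simp add: algebra_simps)
qed

lemma nu2_eq:
  assumes "two_adic_eq q e" shows "nu2 q = ereal (of_int e)"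
proof -
  obtain a d where ad: "odd a" "odd d" "q = of_int a / of_int d * 2 powi e"
    using assms(1) by (auto simp: two_adic_eq_def)
  obtain n D where nD: "quotient_of q = (n, D)" by (cases "quotient_of q")
  have D: "D > 0" using quotient_of_denom_pos[OF nD] .
  have q: "q = of_int n / of_int D" using quotient_of_div[OF nD] .
  have q0: "q \<noteq> 0" using ad by auto
  then have n0: "n \<noteq> 0" using q by auto
  have e: "(2::rat) powi e = 2 ^ nat e / 2 ^ nat (- e)"
    by (simp add: power_int_def power_inverse inverse_eq_divide power_one_over)
  have "(of_int (n * d * 2 ^ nat (- e)) :: rat) = of_int (a * 2 ^ nat e * D)"
    using ad(2,3) q D unfolding e by (auto simp: field_simps)
  then have eq: "n * d * 2 ^ nat (- e) = a * 2 ^ nat e * D" by (simp only: of_int_eq_iff)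
  have odd0: "multiplicity 2 x = 0" if "odd x" for x :: int
    using that by (simp add: not_dvd_imp_multiplicity_0)
  have "multiplicity 2 (n * d * 2 ^ nat (- e)) = multiplicity 2 n + nat (- e)"
    using n0 ad(2) odd0[OF ad(2)]
    by (subst prime_elem_multiplicity_mult_distrib; (subst prime_elem_multiplicity_mult_distrib)?)
       (auto simp: prime_elem_multiplicity_power_distrib)
  moreover have "multiplicity 2 (a * 2 ^ nat e * D) = nat e + multiplicity 2 D"
    using D ad(1) odd0[OF ad(1)]
    by (subst prime_elem_multiplicity_mult_distrib; (subst prime_elem_multiplicity_mult_distrib)?)
       (auto simp: prime_elem_multiplicity_power_distrib)
  ultimately have "multiplicity 2 n + nat (- e) = nat e + multiplicity 2 D" using eq by simp
  then have "real (multiplicity 2 n) - real (multiplicity 2 D) = of_int e" by linarith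
  then show ?thesis using q0 nD by (simp add: nu2_def)
qed

section \<open>Valuations of factorials and binomial coefficients\<close>

abbreviation fact_val :: "nat \<Rightarrow> nat" where
  "fact_val n \<equiv> multiplicity 2 (fact n :: nat)"

lemma fact_val_Suc: "fact_val (Suc n) = multiplicity 2 (Suc n) + fact_val n"
  by (simp add: prime_elem_multiplicity_mult_distrib del: mult_Suc)

lemma fact_val_Suc_odd: "odd (Suc n) \<Longrightarrow> fact_val (Suc n) = fact_val n"
  unfolding fact_val_Suc by (simp add: not_dvd_imp_multiplicity_0)

lemma multiplicity_two_double: "n > 0 \<Longrightarrow> multiplicity 2 (2 * n :: nat) = Suc (multiplicity 2 n)"
  by (simp add: multiplicity_times_same)

lemma fact_val_double: "fact_val (2 * n) = n + fact_val n"
proof (induction n)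
  case (Suc n)
  have "fact_val (2 * Suc n) = multiplicity 2 (2 * Suc n) + fact_val (Suc (2 * n))"
    using fact_val_Suc[of "Suc (2 * n)"] by simp
  also have "fact_val (Suc (2 * n)) = fact_val (2 * n)" by (rule fact_val_Suc_odd) simp
  finally show ?case
    using Suc multiplicity_two_double[of "Suc n"] fact_val_Suc[of n] by simp
qed simp

lemma fact_val_add: "fact_val m + fact_val n \<le> fact_val (m + n)"
proof -
  have "fact_val m + fact_val n = multiplicity 2 (fact m * fact n :: nat)"
    by (simp add: prime_elem_multiplicity_mult_distrib)
  also have "\<dots> \<le> fact_val (m + n)"
    by (intro dvd_imp_multiplicity_le) (auto simp: fact_fact_dvd_fact)
  finally show ?thesis .
qed

lemma binary_digit_sum_double: "binary_digit_sum (2 * n) = binary_digit_sum n"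
  by (cases "n = 0") (simp_all add: binary_digit_sum.simps[of "2 * n"] binary_digit_sum.simps[of 0])

lemma binary_digit_sum_Suc_double: "binary_digit_sum (Suc (2 * n)) = Suc (binary_digit_sum n)"
  by (simp add: binary_digit_sum.simps[of "Suc (2 * n)"])

lemma legendre_two: "fact_val n + binary_digit_sum n = n"
proof (induction n rule: less_induct)
  case (less n)
  show ?case
  proof (cases "even n")
    case True
    then obtain k where k: "n = 2 * k" by (elim evenE)
    show ?thesis
    proof (cases "k = 0")
      case False
      then show ?thesis using less[of k] k by (simp add: fact_val_double binary_digit_sum_double)
    qed (simp add: k binary_digit_sum.simps)
  next
    case False
    then obtain k where k: "n = Suc (2 * k)" by (auto elim: oddE)
    then have "fact_val n = fact_val (2 * k)" by (simp only: k) (rule fact_val_Suc_odd, simp)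
    then show ?thesis using less[of k] k by (simp add: fact_val_double binary_digit_sum_Suc_double)
  qed
qed

text \<open>
  The valuation of \<open>(2 * j)!\<close> is the exact loss of a binomial coefficient with lower entry \<open>j\<close> and upper entry
  a half-integer. As the valuation of a factorial it is superadditive in \<open>j\<close>, and all estimates below rest on that.
\<close>

definition double_fact_val :: "nat \<Rightarrow> nat" where
  "double_fact_val j = fact_val (2 * j)"

lemma double_fact_val_altdef: "double_fact_val j = j + fact_val j"
  by (simp add: double_fact_val_def fact_val_double)

lemma double_fact_val_add: "double_fact_val i + double_fact_val j \<le> double_fact_val (i + j)"
  using fact_val_add[of "2 * i" "2 * j"] by (simp add: double_fact_val_def distrib_left)

lemma double_fact_val_ge: "j \<le> double_fact_val j"
  by (simp add: double_fact_val_altdef)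

lemma double_fact_val_gap: "i \<le> j \<Longrightarrow> double_fact_val i + (j - i) \<le> double_fact_val j"
  using double_fact_val_add[of i "j - i"] double_fact_val_ge[of "j - i"] by simp

lemma double_fact_val_mono: "i \<le> j \<Longrightarrow> double_fact_val i \<le> double_fact_val j"
  using double_fact_val_gap[of i j] by simp

lemma double_fact_val_gap_3:
  assumes "i + 2 \<le> j" shows "double_fact_val i + 3 \<le> double_fact_val j"
proof -
  have "double_fact_val 2 = 3"
    using fact_val_double[of 1] by (simp add: double_fact_val_altdef numeral_2_eq_2)
  then show ?thesis
    using double_fact_val_add[of i 2] double_fact_val_mono[OF assms] by simp
qed

lemma double_fact_val_double: "double_fact_val (2 * i) = double_fact_val i + 2 * i"
  by (simp add: double_fact_val_altdef fact_val_double)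

text \<open>
  All factors of the numerator are odd integers over \<open>2 ^ Suc s\<close>, so nothing cancels.
\<close>

lemma two_adic_eq_gbinomial:
  assumes "odd a"
  shows "two_adic_eq ((of_int a / 2 ^ Suc s) gchoose k) (- int (s * k + double_fact_val k))"
proof -
  have pow: "(2::rat) powi (- int (Suc s)) = 1 / 2 ^ Suc s"
    by (simp only: power_int_minus power_int_of_nat inverse_eq_divide)
  have "two_adic_eq (of_int a / 2 ^ Suc s - of_nat i) (- int (Suc s))" for i
  proof -
    have "of_int a / 2 ^ Suc s - (of_nat i :: rat) = of_int (a - 2 ^ Suc s * int i) / of_int 1 * 2 powi (- int (Suc s))"
      unfolding pow by (simp add: field_simps)
    moreover have "odd (a - 2 ^ Suc s * int i)" using assms by simp
    ultimately show ?thesis unfolding two_adic_eq_def by (metis odd_one)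
  qed
  then have "two_adic_eq (\<Prod>i = 0..<k. of_int a / 2 ^ Suc s - of_nat i) (int k * (- int (Suc s)))"
    using two_adic_eq_prod[of "{0..<k}"] by simp
  moreover have "two_adic_eq (of_nat (fact k)) (int (fact_val k))"
    by (rule two_adic_eq_of_nat) simp
  ultimately have "two_adic_eq ((\<Prod>i = 0..<k. of_int a / 2 ^ Suc s - of_nat i) / of_nat (fact k))
      (int k * (- int (Suc s)) - int (fact_val k))"
    by (rule two_adic_eq_divide)
  moreover have "int k * (- int (Suc s)) - int (fact_val k) = - int (s * k + double_fact_val k)"
    by (simp add: double_fact_val_altdef algebra_simps)
  ultimately show ?thesis by (simp add: gbinomial_prod_rev)
qed

section \<open>Valuations of the coefficients\<close>

lemma orbit_power_1_nth: "orbit_power (Suc 0) a $ w = a gchoose w"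
  by (simp add: orbit_power.simps(2))

text \<open>
  At level 1 the exponent has become an integer, and the binomial coefficient there is 2-adically integral.
\<close>

lemma orbit_power_2_nth:
  "orbit_power (Suc (Suc 0)) (of_int a / 2 :: rat) $ w =
     (\<Sum>k\<le>w div 3. (of_int a / 2 gchoose k) * (of_int (a - 2 * int k) gchoose (w - 3 * k)))"
proof -
  have "orbit_power (Suc (Suc 0)) (of_int a / 2 :: rat) $ w =
     (\<Sum>k\<le>w. if 3 * k \<le> w then (of_int a / 2 gchoose k) * (of_int (a - 2 * int k) gchoose (w - 3 * k)) else 0)"
    unfolding orbit_power_Suc_nth[of "Suc 0"] orbit_power_1_nth
    by (intro sum.cong) (auto simp: mult.commute)
  also have "\<dots> = (\<Sum>k\<le>w div 3. (of_int a / 2 gchoose k) * (of_int (a - 2 * int k) gchoose (w - 3 * k)))"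
    by (intro sum.mono_neutral_cong_right) (auto simp: less_eq_div_iff_mult_less_eq)
  finally show ?thesis .
qed

lemma two_adic_ge_gbinomial_of_int: "two_adic_ge (of_int c gchoose k) 0"
  by (simp only: two_adic_ge_of_int flip: of_int_gbinomial)

lemma two_adic_ge_level_2_term:
  assumes "odd a"
  shows "two_adic_ge ((of_int a / 2 gchoose k) * (of_int c gchoose l)) (- int (double_fact_val k))"
  using two_adic_ge_mult[OF two_adic_eq_imp_ge[OF two_adic_eq_gbinomial[OF assms, of 0 k]]
      two_adic_ge_gbinomial_of_int[of c l]] by simp

text \<open>
  Using level \<open>r + 3\<close> for \<open>i\<close> times consumes the weight \<open>(2 ^ (r + 3) - 1) * i\<close> and contributes
  \<open>(r + 1) * i + v ((2 * i)!)\<close> powers of 2 to the denominator. Spending the same weight at level 2, that is,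
  in portions of 3, contributes more: by at least \<open>i\<close> for level 3 and by at least \<open>2 * i\<close> for all higher
  levels.
\<close>

lemma weight_loss:
  assumes "(2 ^ Suc (Suc (Suc r)) - 1) * i \<le> w"
  shows "Suc r * i + double_fact_val i + double_fact_val ((w - (2 ^ Suc (Suc (Suc r)) - 1) * i) div 3)
      + (if r = 0 then i else 2 * i) \<le> double_fact_val (w div 3)"
proof -
  define g :: nat where "g = 2 ^ Suc (Suc (Suc r)) - 1"
  define d where "d = g * i div 3"
  have "g * i div 3 + (w - g * i) div 3 \<le> w div 3"
    using assms unfolding g_def[symmetric] by linarith
  then have *: "double_fact_val d + double_fact_val ((w - g * i) div 3) \<le> double_fact_val (w div 3)"
    using double_fact_val_add[of d "(w - g * i) div 3"] double_fact_val_mono order_trans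
    unfolding d_def by blast
  have "Suc r * i + double_fact_val i + (if r = 0 then i else 2 * i) \<le> double_fact_val d"
  proof (cases "r = 0")
    case True
    then have "2 * i \<le> d" by (simp add: d_def g_def)
    from double_fact_val_mono[OF this] show ?thesis
      using True double_fact_val_double[of i] by simp
  next
    case False
    then have "0 < r" by simp
    then have "3 * r + 13 \<le> 2 ^ Suc (Suc (Suc r))"
      by (induction r rule: nat_induct_non_zero) auto
    then have "3 * (r + 4) \<le> g" by (simp add: g_def)
    then have "3 * (r + 4) * i \<le> g * i" by (rule mult_right_mono) simp
    then have "(r + 4) * i \<le> d" unfolding d_def by linarith
    then have "(r + 3) * i + i \<le> d" by (simp add: algebra_simps)
    moreover from this have "double_fact_val i + (d - i) \<le> double_fact_val d"
      by (intro double_fact_val_gap) simp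
    ultimately show ?thesis using False by (simp add: algebra_simps)
  qed
  with * show ?thesis unfolding g_def by linarith
qed

lemma orbit_power_upper_term:
  fixes a :: int and r :: nat
  defines "\<alpha> \<equiv> (of_int a / 2 ^ Suc (Suc r) :: rat)"
  assumes "odd a"
    and lower: "\<And>a w. odd a \<Longrightarrow> two_adic_ge (orbit_power (Suc (Suc r)) (of_int a / 2 ^ Suc r) $ w)
                   (- int (double_fact_val (w div 3)))"
    and i: "(2 ^ Suc (Suc (Suc r)) - 1) * i \<le> w"
    and e: "e \<le> (if r = 0 then i else 2 * i)"
  shows "two_adic_ge ((\<alpha> gchoose i) * orbit_power (Suc (Suc r)) (2 * \<alpha> - 2 * of_nat i) $ (w - (2 ^ Suc (Suc (Suc r)) - 1) * i))
     (int e - int (double_fact_val (w div 3)))"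
proof -
  let ?v = "w - (2 ^ Suc (Suc (Suc r)) - 1) * i"
  have "2 * \<alpha> - 2 * of_nat i = of_int (a - 2 ^ Suc (Suc r) * int i) / 2 ^ Suc r"
    by (simp add: \<alpha>_def field_simps)
  moreover have "odd (a - 2 ^ Suc (Suc r) * int i)" using assms(2) by simp
  ultimately have "two_adic_ge (orbit_power (Suc (Suc r)) (2 * \<alpha> - 2 * of_nat i) $ ?v)
      (- int (double_fact_val (?v div 3)))"
    using lower by metis
  from two_adic_ge_mult[OF two_adic_eq_imp_ge[OF two_adic_eq_gbinomial[OF assms(2)]] this]
  have "two_adic_ge ((\<alpha> gchoose i) * orbit_power (Suc (Suc r)) (2 * \<alpha> - 2 * of_nat i) $ ?v)
     (- int (Suc r * i + double_fact_val i) + - int (double_fact_val (?v div 3)))"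
    unfolding \<alpha>_def .
  then show ?thesis
  proof (rule two_adic_ge_mono)
    show "int e - int (double_fact_val (w div 3))
        \<le> - int (Suc r * i + double_fact_val i) + - int (double_fact_val (?v div 3))"
      using weight_loss[OF i] e by linarith
  qed
qed

text \<open>
  No distribution of the weight \<open>w\<close> beats spending all of it at level 2.
\<close>

lemma two_adic_ge_orbit_power:
  assumes "odd a"
  shows "two_adic_ge (orbit_power (Suc (Suc r)) (of_int a / 2 ^ Suc r) $ w)
           (- int (double_fact_val (w div 3)))"
  using assms
proof (induction r arbitrary: a w)
  case 0
  have "two_adic_ge (\<Sum>k\<le>w div 3. (of_int a / 2 gchoose k) * (of_int (a - 2 * int k) gchoose (w - 3 * k)))
     (- int (double_fact_val (w div 3)))"
    using double_fact_val_mono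
    by (intro two_adic_ge_sum two_adic_ge_mono[OF two_adic_ge_level_2_term[OF 0]]) auto
  then show ?case using orbit_power_2_nth[of a w] by simp
next
  case (Suc r)
  have "two_adic_ge
     (if (2 ^ Suc (Suc (Suc r)) - 1) * i \<le> w
      then (of_int a / 2 ^ Suc (Suc r) gchoose i) *
        orbit_power (Suc (Suc r)) (2 * (of_int a / 2 ^ Suc (Suc r)) - 2 * of_nat i) $ (w - (2 ^ Suc (Suc (Suc r)) - 1) * i)
      else 0) (- int (double_fact_val (w div 3)))" for i
    using orbit_power_upper_term[OF Suc.prems Suc.IH, of i w 0] by (auto simp del: power_Suc)
  then show ?case
    unfolding orbit_power_Suc_nth[of "Suc (Suc r)"] by (intro two_adic_ge_sum)
qed

text \<open>
  Modulo two powers of 2 above the dominating valuation, only those terms survive that use no level from 4 on,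
  and level 3 at most once. The factor \<open>a / 4\<close> is the binomial coefficient of the single use of level 3, and 7
  is its weight.
\<close>

lemma orbit_power_reduction:
  assumes "odd a" "w > 0"
  shows "two_adic_ge (orbit_power (Suc (Suc (Suc r))) (of_int a / 2 ^ Suc (Suc r)) $ w
      - (orbit_power (Suc (Suc 0)) (of_int a / 2) $ w
         + (if 7 \<le> w then of_int a / 4 * orbit_power (Suc (Suc 0)) (of_int (a - 4) / 2) $ (w - 7) else 0)))
      (2 - int (double_fact_val (w div 3)))"
proof (induction r)
  case 0
  define h where "h i = (if 7 * i \<le> w then ((of_int a / 4 :: rat) gchoose i) *
     orbit_power (Suc (Suc 0)) (2 * (of_int a / 4) - 2 * of_nat i) $ (w - 7 * i) else 0)" for i
  have sum: "orbit_power (Suc (Suc (Suc 0))) (of_int a / 4) $ w = (\<Sum>i\<le>w. h i)"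
    unfolding orbit_power_Suc_nth[of "Suc (Suc 0)"] h_def by (intro sum.cong) simp_all
  have "{..w} = insert 0 (insert 1 {2..w})" using assms(2) by auto
  then have split: "(\<Sum>i\<le>w. h i) = h 0 + h 1 + (\<Sum>i\<in>{2..w}. h i)" by simp
  have "two_adic_ge (\<Sum>i\<in>{2..w}. h i) (2 - int (double_fact_val (w div 3)))"
  proof (rule two_adic_ge_sum)
    fix i assume "i \<in> {2..w}"
    then show "two_adic_ge (h i) (2 - int (double_fact_val (w div 3)))"
      using orbit_power_upper_term[OF assms(1) two_adic_ge_orbit_power, of 0 i w 2]
      by (simp add: h_def)
  qed
  moreover have "h 0 = orbit_power (Suc (Suc 0)) (of_int a / 2) $ w" by (simp add: h_def)
  moreover have "h 1 = (if 7 \<le> w then of_int a / 4 * orbit_power (Suc (Suc 0)) (of_int (a - 4) / 2) $ (w - 7) else 0)"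
    by (simp add: h_def diff_divide_distrib)
  ultimately show ?case using sum unfolding split by simp
next
  case (Suc r)
  let ?M = "orbit_power (Suc (Suc 0)) (of_int a / 2) $ w
         + (if 7 \<le> w then of_int a / 4 * orbit_power (Suc (Suc 0)) (of_int (a - 4) / 2) $ (w - 7) else 0)"
  define g :: nat where "g = 2 ^ Suc (Suc (Suc (Suc r))) - 1"
  define \<alpha> :: rat where "\<alpha> = of_int a / 2 ^ Suc (Suc (Suc r))"
  define h where "h i = (if g * i \<le> w then (\<alpha> gchoose i) *
     orbit_power (Suc (Suc (Suc r))) (2 * \<alpha> - 2 * of_nat i) $ (w - g * i) else 0)" for i
  have sum: "orbit_power (Suc (Suc (Suc (Suc r)))) \<alpha> $ w = (\<Sum>i\<le>w. h i)"
    unfolding orbit_power_Suc_nth[of "Suc (Suc (Suc r))"] h_def g_def ..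
  have "{..w} = insert 0 {1..w}" by auto
  then have split: "(\<Sum>i\<le>w. h i) = h 0 + (\<Sum>i\<in>{1..w}. h i)" by simp
  have "two_adic_ge (\<Sum>i\<in>{1..w}. h i) (2 - int (double_fact_val (w div 3)))"
  proof (rule two_adic_ge_sum)
    fix i assume "i \<in> {1..w}"
    then show "two_adic_ge (h i) (2 - int (double_fact_val (w div 3)))"
      using orbit_power_upper_term[OF assms(1) two_adic_ge_orbit_power, of "Suc r" i w 2]
      unfolding h_def g_def \<alpha>_def by (auto simp del: power_Suc)
  qed
  moreover have "h 0 = orbit_power (Suc (Suc (Suc r))) (of_int a / 2 ^ Suc (Suc r)) $ w"
    by (simp add: h_def \<alpha>_def)
  moreover have "(h 0 - ?M) + (\<Sum>i\<in>{1..w}. h i) = orbit_power (Suc (Suc (Suc (Suc r)))) \<alpha> $ w - ?M"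
    unfolding sum split by simp
  ultimately show ?case using Suc.IH unfolding \<alpha>_def by (metis two_adic_ge_add)
qed

text \<open>
  Of the level 2 terms the last one dominates strictly, provided that its level 1 coefficient is odd.
\<close>

lemma two_adic_eq_level_2:
  assumes "odd a" "two_adic_eq (of_int (a - 2 * int (w div 3)) gchoose (w mod 3)) 0"
  shows "two_adic_eq (orbit_power (Suc (Suc 0)) (of_int a / 2) $ w) (- int (double_fact_val (w div 3)))"
proof -
  let ?j = "w div 3"
  let ?t = "\<lambda>k. (of_int a / 2 gchoose k) * (of_int (a - 2 * int k) gchoose (w - 3 * k) :: rat)"
  have "two_adic_ge (\<Sum>k<?j. ?t k) (- int (double_fact_val ?j) + 1)"
  proof (rule two_adic_ge_sum)
    fix k assume "k \<in> {..<?j}"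
    then have "- int (double_fact_val ?j) + 1 \<le> - int (double_fact_val k)"
      using double_fact_val_gap[of k ?j] by simp
    then show "two_adic_ge (?t k) (- int (double_fact_val ?j) + 1)"
      using two_adic_ge_mono[OF two_adic_ge_level_2_term[OF assms(1)]] by blast
  qed
  moreover have "two_adic_eq (?t ?j) (- int (double_fact_val ?j))"
    using two_adic_eq_mult[OF two_adic_eq_gbinomial[OF assms(1), of 0 ?j] assms(2)]
    by (simp add: minus_mult_div_eq_mod)
  ultimately have "two_adic_eq (?t ?j + (\<Sum>k<?j. ?t k)) (- int (double_fact_val ?j))"
    by (intro two_adic_eq_add_ge)
  then show ?thesis unfolding orbit_power_2_nth lessThan_Suc_atMost[symmetric] by (simp add: add.commute)
qed

lemma orbit_power_valuation_generic:
  assumes "odd a" "w > 0" "two_adic_eq (of_int (a - 2 * int (w div 3)) gchoose (w mod 3)) 0"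
  shows "two_adic_eq (orbit_power (Suc (Suc (Suc r))) (of_int a / 2 ^ Suc (Suc r)) $ w)
      (- int (double_fact_val (w div 3)))"
proof -
  define L :: rat where "L = orbit_power (Suc (Suc (Suc r))) (of_int a / 2 ^ Suc (Suc r)) $ w"
  define P :: rat where "P = orbit_power (Suc (Suc 0)) (of_int a / 2) $ w"
  define M where "M = (if 7 \<le> w then of_int a / 4 * orbit_power (Suc (Suc 0)) (of_int (a - 4) / 2) $ (w - 7) else 0 :: rat)"
  define e where "e = - int (double_fact_val (w div 3))"
  have "two_adic_ge M (e + 1)"
  proof (cases "7 \<le> w")
    case True
    have q: "two_adic_eq (of_int a / 4) (-2)"
      using two_adic_eq_divide[OF two_adic_eq_of_int[OF assms(1)] two_adic_eq_power_int[of 2]] by simp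
    have "two_adic_ge (orbit_power (Suc (Suc 0)) (of_int (a - 4) / 2) $ (w - 7)) (- int (double_fact_val ((w - 7) div 3)))"
      using two_adic_ge_orbit_power[of "a - 4" 0 "w - 7"] assms(1) by simp
    from two_adic_ge_mult[OF two_adic_eq_imp_ge[OF q] this]
    have "two_adic_ge M (- 2 + - int (double_fact_val ((w - 7) div 3)))" using True by (simp add: M_def)
    moreover have "(w - 7) div 3 + 2 \<le> w div 3" using True by linarith
    then have "e + 1 \<le> - 2 + - int (double_fact_val ((w - 7) div 3))"
      using double_fact_val_gap_3[of "(w - 7) div 3" "w div 3"] by (simp add: e_def)
    ultimately show ?thesis by (rule two_adic_ge_mono)
  qed (simp add: M_def)
  moreover have "two_adic_ge (L - (P + M)) (e + 1)"
    using orbit_power_reduction[OF assms(1,2), of r] unfolding L_def P_def M_def e_def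
    by (rule two_adic_ge_mono) simp
  ultimately have "two_adic_ge (L - (P + M) + M) (e + 1)" by (intro two_adic_ge_add)
  moreover have "two_adic_eq P e"
    unfolding P_def e_def by (rule two_adic_eq_level_2[OF assms(1,3)])
  ultimately have "two_adic_eq (P + (L - (P + M) + M)) e" by (intro two_adic_eq_add_ge)
  then show ?thesis by (simp add: L_def e_def)
qed

text \<open>
  Here \<open>w = m + 1 = 3 * j + 2\<close> with \<open>j = 8 * t + 7\<close>, and the level 1 coefficient of the dominating term is
  even. At the next power of 2 there are three candidates: level 2 used \<open>j\<close> times, level 2 used \<open>j - 1\<close> times, and
  level 2 used \<open>j - 2\<close> times together with one use of level 3. The first two are both \<open>t + 1\<close> times a number of
  that valuation. So their sum is negligible whatever the parity of \<open>t + 1\<close>, and the third, whose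
  level 1 coefficient is odd, determines the valuation.
\<close>

lemma orbit_power_valuation_exceptional:
  fixes t :: nat
  defines "a \<equiv> 12 * int t + 11" and "w \<equiv> 24 * t + 23"
  shows "two_adic_eq (orbit_power (Suc (Suc (Suc r))) (of_int a / 2 ^ Suc (Suc r)) $ w)
      (1 - int (double_fact_val (w div 3)))"
proof -
  define e where "e = int (double_fact_val (8 * t + 7))"
  have w3: "w div 3 = 8 * t + 7" by (simp add: w_def)
  have a: "odd a" by (simp add: a_def)
  have f6: "int (double_fact_val (8 * t + 6)) = e - 1"
    using fact_val_Suc_odd[of "8 * t + 6"] by (simp add: e_def double_fact_val_altdef add.commute)
  have f5: "int (double_fact_val (8 * t + 5)) = e - 3"
  proof -
    have "multiplicity 2 (2 * (4 * t + 3)) = Suc (multiplicity 2 (4 * t + 3))"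
      by (rule multiplicity_two_double) simp
    moreover have "multiplicity 2 (4 * t + 3) = 0"
      by (rule not_dvd_imp_multiplicity_0) presburger
    moreover have "2 * (4 * t + 3) = Suc (8 * t + 5)" by simp
    ultimately have "multiplicity 2 (Suc (8 * t + 5)) = 1" by (simp only:)
    moreover have "Suc (8 * t + 5) = 8 * t + 6" by simp
    ultimately have "fact_val (8 * t + 6) = 1 + fact_val (8 * t + 5)"
      using fact_val_Suc[of "8 * t + 5"] by (simp only:)
    then show ?thesis using f6 by (simp only: double_fact_val_altdef)
  qed
  let ?t = "\<lambda>k. (of_int a / 2 gchoose k) * (of_int (a - 2 * int k) gchoose (w - 3 * k) :: rat)"
  have "{..w div 3} = insert (8 * t + 7) (insert (8 * t + 6) {..<8 * t + 6})" by (auto simp: w3)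
  then have split: "orbit_power (Suc (Suc 0)) (of_int a / 2) $ w
      = (?t (8 * t + 7) + ?t (8 * t + 6)) + (\<Sum>k<8 * t + 6. ?t k)"
    unfolding orbit_power_2_nth by simp
  have small: "two_adic_ge (\<Sum>k<8 * t + 6. ?t k) (2 - e)"
  proof (rule two_adic_ge_sum)
    fix k assume "k \<in> {..<8 * t + 6}"
    then have "2 - e \<le> - int (double_fact_val k)"
      using double_fact_val_gap[of k "8 * t + 7"] by (simp add: e_def)
    then show "two_adic_ge (?t k) (2 - e)"
      using two_adic_ge_mono[OF two_adic_ge_level_2_term[OF a]] by blast
  qed
  \<comment> \<open>The level 1 coefficients are \<open>2 * (4 * t + 3) * (t + 1)\<close> for \<open>j\<close> uses of level 2 and, for \<open>j - 1\<close> uses,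
     a fraction with odd denominator 15 that has the factor \<open>t + 1\<close> as well.\<close>
  define X where "X = (of_int a / 2 gchoose (8 * t + 7)) * (of_int (4 * int t + 3) * (2 powi 1) :: rat)"
  define Y where "Y = (of_int a / 2 gchoose (8 * t + 6))
     * (of_int (- ((4 * int t + 1) * (2 * int t + 1) * (4 * int t + 3) * (4 * int t + 5))) / of_int 15 :: rat)"
  have "two_adic_eq X (- int (0 * (8 * t + 7) + double_fact_val (8 * t + 7)) + (0 + 1))"
    unfolding X_def
    by (intro two_adic_eq_mult two_adic_eq_of_int two_adic_eq_power_int
        two_adic_eq_gbinomial[OF a, of 0, simplified power_Suc power_0 mult_1_right]) simp
  then have X: "two_adic_eq X (1 - e)" by (simp add: e_def)
  have "two_adic_eq Y (- int (0 * (8 * t + 6) + double_fact_val (8 * t + 6)) + (0 - 0))"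
    unfolding Y_def
    by (intro two_adic_eq_mult two_adic_eq_divide two_adic_eq_of_int
        two_adic_eq_gbinomial[OF a, of 0, simplified power_Suc power_0 mult_1_right]) simp_all
  then have Y: "two_adic_eq Y (1 - e)" by (simp add: f6)
  have g2: "x gchoose 2 = x * (x - 1) / 2" for x :: rat
    by (simp add: gbinomial_prod_rev eval_nat_numeral)
  have g5: "x gchoose 5 = x * (x - 1) * (x - 2) * (x - 3) * (x - 4) / 120" for x :: rat
    by (simp add: gbinomial_prod_rev eval_nat_numeral)
  have "?t (8 * t + 7) = of_nat (t + 1) * X"
    by (simp add: w_def a_def X_def g2 field_simps)
  moreover have "?t (8 * t + 6) = of_nat (t + 1) * Y"
    by (simp add: w_def a_def Y_def g5 field_simps)
  ultimately have "?t (8 * t + 7) + ?t (8 * t + 6) = of_nat (t + 1) * (X + Y)"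
    by (simp only: distrib_left)
  moreover have "two_adic_ge (of_nat (t + 1) * (X + Y)) (0 + (1 - e + 1))"
    using two_adic_ge_of_int[of "int (t + 1)"] two_adic_eq_add_eq[OF X Y]
    by (intro two_adic_ge_mult) simp_all
  ultimately have "two_adic_ge (?t (8 * t + 7) + ?t (8 * t + 6)) (2 - e)" by simp
  then have low: "two_adic_ge (orbit_power (Suc (Suc 0)) (of_int a / 2) $ w) (2 - e)"
    unfolding split using small by (rule two_adic_ge_add)
  have "two_adic_eq (orbit_power (Suc (Suc 0)) (of_int (a - 4) / 2) $ (w - 7)) (- int (double_fact_val ((w - 7) div 3)))"
  proof (rule two_adic_eq_level_2)
    have "(w - 7) div 3 = 8 * t + 5" "(w - 7) mod 3 = 1" by (simp_all add: w_def) presburger+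
    moreover have "odd (- 4 * int t - 3)" by simp
    ultimately show "two_adic_eq (of_int (a - 4 - 2 * int ((w - 7) div 3)) gchoose ((w - 7) mod 3)) 0"
      using two_adic_eq_of_int[of "- 4 * int t - 3"] by (simp add: a_def)
  qed (simp add: a)
  moreover have "(w - 7) div 3 = 8 * t + 5" by (simp add: w_def)
  ultimately have "two_adic_eq (orbit_power (Suc (Suc 0)) (of_int (a - 4) / 2) $ (w - 7)) (3 - e)"
    using f5 by simp
  then have "two_adic_eq (of_int a / 2 powi 2 * orbit_power (Suc (Suc 0)) (of_int (a - 4) / 2) $ (w - 7)) ((0 - 2) + (3 - e))"
    by (intro two_adic_eq_mult two_adic_eq_divide two_adic_eq_of_int[OF a] two_adic_eq_power_int)
  then have unit: "two_adic_eq (of_int a / 4 * orbit_power (Suc (Suc 0)) (of_int (a - 4) / 2) $ (w - 7)) (1 - e)"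
    by simp
  have rest: "two_adic_ge (orbit_power (Suc (Suc (Suc r))) (of_int a / 2 ^ Suc (Suc r)) $ w
      - (orbit_power (Suc (Suc 0)) (of_int a / 2) $ w
         + of_int a / 4 * orbit_power (Suc (Suc 0)) (of_int (a - 4) / 2) $ (w - 7))) (2 - e)"
    using orbit_power_reduction[OF a, of w r] unfolding w3 e_def[symmetric] by (simp add: w_def)
  have "two_adic_ge (orbit_power (Suc (Suc (Suc r))) (of_int a / 2 ^ Suc (Suc r)) $ w
         - of_int a / 4 * orbit_power (Suc (Suc 0)) (of_int (a - 4) / 2) $ (w - 7)) (1 - e + 1)"
    using two_adic_ge_add[OF rest low] by simp
  from two_adic_eq_add_ge[OF unit this] show ?thesis
    unfolding w3 e_def by simp
qed

text \<open>
  With \<open>N\<close> for the upper entry, which is always odd, only the lower entry 2 is at stake. In this case the coefficient is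
  \<open>N * (N - 1) / 2\<close>, and \<open>N - 1\<close> is divisible by 4 exactly if \<open>m \<equiv> 22 (mod 24)\<close>.
\<close>

lemma leading_binomial_odd:
  assumes m: "[m = 2] (mod 4)" and ne: "\<not> [m = 22] (mod 24)"
  shows "two_adic_eq (of_int (int (m div 2) - 2 * int (Suc m div 3)) gchoose (Suc m mod 3)) 0"
proof -
  define p j where "p = m div 4" and "j = Suc m div 3"
  define N M where "N = int (m div 2) - 2 * int j" and "M = int p - int j"
  have m4: "m = 4 * p + 2" using m div_mult_mod_eq[of m 4] by (simp add: cong_def p_def)
  then have "m div 2 = 2 * p + 1" by simp
  then have N: "N = 2 * M + 1" by (simp add: N_def M_def)
  have oddN: "odd N" by (simp add: N)
  consider "Suc m mod 3 = 0" | "Suc m mod 3 = 1" | "Suc m mod 3 = 2" by linarith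
  then have "two_adic_eq (of_int N gchoose (Suc m mod 3)) 0"
  proof cases
    case 1
    then show ?thesis using two_adic_eq_of_int[of 1] by simp
  next
    case 2
    then show ?thesis using two_adic_eq_of_int[OF oddN] by simp
  next
    case 3
    have "Suc m = 3 * j + 2" using 3 div_mult_mod_eq[of "Suc m" 3] by (simp add: j_def)
    then have "3 * j = 4 * p + 1" using m4 by simp
    then have "int (3 * j) = int (4 * p + 1)" by (simp only:)
    then have mM: "int m = - 2 - 12 * M" by (simp add: m4 M_def)
    have "odd M"
    proof
      assume "even M"
      then obtain K where "M = 2 * K" by (elim evenE)
      then have "int m = 22 + (- K - 1) * 24" using mM by simp
      then have "int m mod 24 = 22 mod 24" by (metis mod_mult_self1)
      then have "int (m mod 24) = int 22" unfolding zmod_int by simp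
      then have "m mod 24 = 22" by (simp only: of_nat_eq_iff)
      then show False using ne by (simp add: cong_def)
    qed
    then have "odd (N * M)" using oddN by simp
    moreover have "of_int N gchoose 2 = (of_int (N * M) :: rat)"
      by (simp add: N gbinomial_prod_rev eval_nat_numeral)
    ultimately show ?thesis using two_adic_eq_of_int[of "N * M"] 3 by simp
  qed
  then show ?thesis by (simp add: N_def j_def)
qed

theorem orbit_power_valuation:
  assumes m: "[m = 2] (mod 4)"
  shows "two_adic_eq (orbit_power (Suc (Suc (Suc r))) (of_nat m / 2 ^ Suc (Suc (Suc r))) $ Suc m)
      (1 - int (eps m) - int (fact_val (2 * Suc m div 3)))"
proof -
  define a where "a = int (m div 2)"
  have m4: "m = 4 * (m div 4) + 2" using m div_mult_mod_eq[of m 4] by (simp add: cong_def)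
  then have m2: "m div 2 = 2 * (m div 4) + 1" by linarith
  have a: "odd a" "int m = 2 * a" using m4 unfolding a_def m2 by simp_all
  have arg: "(of_nat m / 2 ^ Suc (Suc (Suc r)) :: rat) = of_int a / 2 ^ Suc (Suc r)"
  proof -
    have "(of_nat m :: rat) = 2 * of_int a" using arg_cong[OF a(2), of of_int] by simp
    then show ?thesis by simp
  qed
  have fv: "fact_val (2 * Suc m div 3) = double_fact_val (Suc m div 3)"
  proof -
    define j where "j = Suc m div 3"
    have j: "Suc m = 3 * j + Suc m mod 3" using div_mult_mod_eq[of "Suc m" 3] unfolding j_def by linarith
    have "2 * Suc m div 3 = (if Suc m mod 3 = 2 then Suc (2 * j) else 2 * j)"
    proof (rule div_nat_eqI)
      show "3 * (if Suc m mod 3 = 2 then Suc (2 * j) else 2 * j) \<le> 2 * Suc m"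
        using j by (cases "Suc m mod 3 = 2") auto
      have "Suc m mod 3 < 3" by simp
      then show "2 * Suc m < 3 * Suc (if Suc m mod 3 = 2 then Suc (2 * j) else 2 * j)"
        using j by (cases "Suc m mod 3 = 2") auto
    qed
    then show ?thesis
      using fact_val_Suc_odd[of "2 * j"] unfolding double_fact_val_def j_def[symmetric]
      by (cases "Suc m mod 3 = 2") (simp_all del: fact_Suc)
  qed
  show ?thesis
  proof (cases "[m = 22] (mod 24)")
    case True
    define t where "t = m div 24"
    have m24: "m = 24 * t + 22" using True div_mult_mod_eq[of m 24] by (simp add: cong_def t_def)
    then have t: "Suc m = 24 * t + 23" "a = 12 * int t + 11" by (simp_all add: a_def)
    show ?thesis
      using orbit_power_valuation_exceptional[of r t, folded t] True
      unfolding arg fv by (simp add: eps_def)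
  next
    case False
    show ?thesis
      using orbit_power_valuation_generic[OF a(1) _ leading_binomial_odd[OF m False, folded a_def], of r] False
      unfolding arg fv by (simp add: eps_def)
  qed
qed

theorem theorem4:
  fixes \<psi> :: "complex \<Rightarrow> complex" and b :: "nat \<Rightarrow> complex" and m :: nat
  assumes "mandelbrot_exterior_map \<psi> b"
    and "m > 0"
    and "[m = 2] (mod 4)"
  shows "\<exists>q::rat. b m = of_rat q \<and>
    - nu2 q = ereal (real (nat \<lfloor>(2/3 :: real) * real (m + 1)\<rfloor>)
                     - real (binary_digit_sum (nat \<lfloor>(2/3 :: real) * real (m + 1)\<rfloor>))
                     + real (eps m))"
proof -
  interpret exterior_map \<psi> b by unfold_locales (rule assms(1))
  \<comment> \<open>Any level at least 3 with \<open>m + 1 < 2 ^ (n + 1) - 1\<close> would do.\<close>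
  define n where "n = Suc (Suc (Suc m))"
  define C :: rat where "C = orbit_power n (of_nat m / 2 ^ n) $ Suc m"
  define N where "N = 2 * Suc m div 3"
  have floor: "nat \<lfloor>(2/3 :: real) * real (m + 1)\<rfloor> = N"
    using floor_divide_of_nat_eq[of "2 * Suc m" 3, where ?'a = real] by (simp add: N_def algebra_simps)
  have "m < 2 ^ m" by (rule less_exp)
  moreover have "(2::nat) ^ Suc n = 16 * 2 ^ m" by (simp add: n_def)
  ultimately have "Suc m < 2 ^ Suc n - 1" by linarith
  from coefficient_formula[OF this] have "of_rat C = - of_nat m * b m"
    by (simp add: C_def of_rat_orbit_power_nth of_rat_divide of_rat_power)
  then have bm: "b m = of_rat (- C / of_nat m)"
    using assms(2) by (simp add: of_rat_divide of_rat_minus)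
  have m4: "m = 4 * (m div 4) + 2" using assms(3) div_mult_mod_eq[of m 4] by (simp add: cong_def)
  then have m2: "m div 2 = 2 * (m div 4) + 1" by linarith
  have "odd (int (m div 2))" "int m = int (m div 2) * 2" using m4 m2 by simp_all
  then have "two_adic_eq (of_int (- int (m div 2)) * 2 powi 1) (0 + 1)"
    by (intro two_adic_eq_mult two_adic_eq_of_int two_adic_eq_power_int) simp
  moreover have "of_int (- int (m div 2)) * 2 powi 1 = (- of_nat m :: rat)"
    using \<open>int m = int (m div 2) * 2\<close> by (metis mult_minus_left of_int_minus of_int_mult of_int_numeral of_int_of_nat_eq power_int_1_right)
  ultimately have "two_adic_eq (- of_nat m) 1" by simp
  from two_adic_eq_divide[OF orbit_power_valuation[OF assms(3), of m] this]
  have "two_adic_eq (C / - of_nat m) (1 - int (eps m) - int (fact_val N) - 1)"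
    unfolding C_def n_def N_def .
  moreover have "1 - int (eps m) - int (fact_val N) - 1 = - (int (fact_val N) + int (eps m))" by simp
  moreover have "C / - of_nat m = - C / of_nat m" by simp
  ultimately have "two_adic_eq (- C / of_nat m) (- (int (fact_val N) + int (eps m)))" by (simp only:)
  from nu2_eq[OF this] have "- nu2 (- C / of_nat m) = ereal (of_int (int (fact_val N) + int (eps m)))"
    by simp
  also have "of_int (int (fact_val N) + int (eps m)) = real N - real (binary_digit_sum N) + real (eps m)"
    using legendre_two[of N] by linarith
  finally show ?thesis unfolding floor using bm by blast
qed

end
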